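(* Let $n$ be a positive integer, $G$ a finite group and $S$ a finite set with a $G$-action. Then the bounded poset $\hat{\mathcal{D}}_n(G,S)=\mathcal{D}_n(G,S)\cup\{\hat 1\}$, obtained from the $S$-Dowling poset by adjoining a new top element $\hat 1$ with $x\prec\hat 1$ for all $x\in\mathcal{D}_n(G,S)$, is EL-shellable.
   Context: Let $[n]=\{1,\dots,n\}$. A partial $G$-partition of $[n]$ is a set $\tilde\beta=\{\tilde B_1,\dots,\tilde B_\ell\}$ where $\{B_1,\dots,B_\ell\}$ is a partition of a subset $\bigcup B_i\subseteq[n]$ into nonempty blocks, and each $\tilde B_i$ consists of $B_i$ together with a function $b_i\colon B_i\to G$ considered up to the equivalence $b_i\sim b_i g$ ($g\in G$, right multiplication). The zero block is $Z=[n]\setminus\bigcup B_i$. The $S$-Dowling poset $\mathcal{D}_n(G,S)$ is the set of pairs $(\tilde\beta,z)$ with $\tilde\beta$ a partial $G$-partition of $[n]$ and $z\colon Z\to S$ any function. Its partial order is generated by the following covering relations: (merge) $(\tilde\beta\cup\{\tilde A,\tilde B\},z)\prec(\tilde\beta\cup\{\tilde C\},z)$ where $C=A\cup B$ and $c|_A=a$, $c|_B=b\cdot g$ for some $g\in G$; (color) $(\tilde\beta\cup\{\tilde B\},z)\prec(\tilde\beta,z')$ where $z'$ extends $z$ to $Z\cup B$ and $z'(i)=b(i)\cdot s$ for all $i\in B$, for some $s\in S$. A bounded poset $P$ is EL-shellable if there is a map $\lambda$ from the covering pairs $x\prec\!\cdot\,y$ of $P$ to some poset such that in every closed interval $[x,y]$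 there is a unique maximal chain whose label word is strictly increasing, and this chain's word lexicographically precedes the words of all other maximal chains of $[x,y]$. *)

theory Defs
  imports
    "HOL-Library.FuncSet"
    "HOL-Library.Disjoint_Sets"
    "HOL-Algebra.Group_Action"
begin

section \<open>EL-shellability of bounded posets\<close>

definition bounded_poset :: "'a set \<Rightarrow> 'a rel \<Rightarrow> bool" where
  "bounded_poset P r \<longleftrightarrow> partial_order_on P r \<and>
     (\<exists>b\<in>P. \<forall>x\<in>P. (b, x) \<in> r) \<and> (\<exists>t\<in>P. \<forall>x\<in>P. (x, t) \<in> r)"

definition interval :: "'a rel \<Rightarrow> 'a \<Rightarrow> 'a \<Rightarrow> 'a set" where
  "interval r x y = {w. (x, w) \<in> r \<and> (w, y) \<in> r}"

definition covering_pairs :: "'a rel \<Rightarrow> ('a \<times> 'a) set" where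
  "covering_pairs r = {(x, y). (x, y) \<in> r \<and> x \<noteq> y \<and> interval r x y = {x, y}}"

definition strictly_increasing :: "'a rel \<Rightarrow> 'a list \<Rightarrow> bool" where
  "strictly_increasing r xs \<longleftrightarrow> sorted_wrt (\<lambda>u v. (u, v) \<in> r - Id) xs"

text \<open>A maximal chain of \<open>[x, y]\<close>, listed in increasing order.\<close>

definition maximal_chain :: "'a rel \<Rightarrow> 'a \<Rightarrow> 'a \<Rightarrow> 'a list \<Rightarrow> bool" where
  "maximal_chain r x y xs \<longleftrightarrow>
     strictly_increasing r xs \<and> set xs \<subseteq> interval r x y \<and>
     (\<forall>w\<in>interval r x y. (\<forall>u\<in>set xs. (u, w) \<in> r \<or> (w, u) \<in> r) \<longrightarrow> w \<in> set xs)"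

definition label_word :: "('a \<times> 'a \<Rightarrow> 'l) \<Rightarrow> 'a list \<Rightarrow> 'l list" where
  "label_word lam xs = map lam (zip xs (tl xs))"

definition EL_labeling :: "'a rel \<Rightarrow> 'l set \<Rightarrow> 'l rel \<Rightarrow> ('a \<times> 'a \<Rightarrow> 'l) \<Rightarrow> bool" where
  "EL_labeling r L q lam \<longleftrightarrow>
     partial_order_on L q \<and> lam \<in> covering_pairs r \<rightarrow> L \<and>
     (\<forall>(x, y)\<in>r.
        (\<exists>!xs. maximal_chain r x y xs \<and> strictly_increasing q (label_word lam xs)) \<and>
        (\<forall>xs ys. maximal_chain r x y xs \<and> strictly_increasing q (label_word lam xs) \<and>
           maximal_chain r x y ys \<and> ys \<noteq> xs \<longrightarrow>
           (label_word lam xs, label_word lam ys) \<in> lexord (q - Id)))"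

text \<open>
  HOL cannot quantify over the type of labels inside a formula. Only the labels of pairs
  matter, so posets of labels on the type \<open>'a \<times> 'a\<close> lose no generality:
  see the lemma \<open>EL_shellableI\<close> below, where the type of labels is arbitrary.
\<close>

definition EL_shellable :: "'a set \<Rightarrow> 'a rel \<Rightarrow> bool" where
  "EL_shellable P r \<longleftrightarrow> bounded_poset P r \<and>
     (\<exists>(L :: ('a \<times> 'a) set) q lam. EL_labeling r L q lam)"

lemma lexord_map_iff:
  assumes "inj_on f (set us \<union> set vs)"
    and "\<And>u v. u \<in> set us \<union> set vs \<Longrightarrow> v \<in> set us \<union> set vs \<Longrightarrow> (f u, f v) \<in> r' \<longleftrightarrow> (u, v) \<in> r"
  shows "(map f us, map f vs) \<in> lexord r' \<longleftrightarrow> (us, vs) \<in> lexord r"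
  using assms
proof (induction us arbitrary: vs)
  case Nil
  then show ?case by (cases vs) auto
next
  case (Cons u us)
  show ?case
  proof (cases vs)
    case Nil
    then show ?thesis by simp
  next
    case vs: (Cons v vs')
    have "(map f us, map f vs') \<in> lexord r' \<longleftrightarrow> (us, vs') \<in> lexord r"
      by (rule Cons.IH) (use Cons.prems vs in \<open>auto simp: inj_on_def\<close>)
    moreover have "f u = f v \<longleftrightarrow> u = v"
      using Cons.prems(1) vs by (auto simp: inj_on_def)
    moreover have "(f u, f v) \<in> r' \<longleftrightarrow> (u, v) \<in> r"
      using Cons.prems(2)[of u v] vs by simp
    ultimately show ?thesis using vs by simp
  qed
qed

lemma EL_shellableI:
  fixes r :: "'a rel" and L :: "'l set"
  assumes "bounded_poset P r" and EL: "EL_labeling r L q lam"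
  shows "EL_shellable P r"
proof -
  define f where "f = inv_into UNIV lam"
  define mu where "mu = f \<circ> lam"
  define L' where "L' = f ` (L \<inter> range lam)"
  define q' where "q' = {(f u, f v) | u v. u \<in> range lam \<and> v \<in> range lam \<and> (u, v) \<in> q}"
  have inj: "inj_on f (range lam)"
    unfolding f_def by (rule inj_on_inv_into) simp
  have q'_iff: "(f u, f v) \<in> q' \<longleftrightarrow> (u, v) \<in> q" if "u \<in> range lam" "v \<in> range lam" for u v
  proof
    assume "(f u, f v) \<in> q'"
    then obtain u' v' where "f u = f u'" "f v = f v'" "u' \<in> range lam" "v' \<in> range lam" "(u', v') \<in> q"
      unfolding q'_def by blast
    then show "(u, v) \<in> q"
      using that inj_onD[OF inj, of u u'] inj_onD[OF inj, of v v'] by simp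
  next
    assume "(u, v) \<in> q"
    then show "(f u, f v) \<in> q'"
      using that unfolding q'_def by blast
  qed
  have q'_Id: "(f u, f v) \<in> q' - Id \<longleftrightarrow> (u, v) \<in> q - Id"
    if "u \<in> range lam" "v \<in> range lam" for u v
    using q'_iff[OF that] inj_on_eq_iff[OF inj that] by simp
  have q: "q \<subseteq> L \<times> L" "refl_on L q" "trans q" "antisym q"
    using EL by (auto simp: EL_labeling_def partial_order_on_def preorder_on_def)
  have q'_cases: "\<exists>u v. e = f u \<and> e' = f v \<and> u \<in> range lam \<and> v \<in> range lam \<and> (u, v) \<in> q"
    if "(e, e') \<in> q'" for e e'
    using that unfolding q'_def by blast
  have "q' \<subseteq> L' \<times> L'"
    using q(1) unfolding q'_def L'_def by blast
  moreover have "refl_on L' q'"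
  proof (rule refl_onI)
    fix e assume "e \<in> L'"
    then obtain u where "e = f u" "u \<in> L" "u \<in> range lam"
      unfolding L'_def by blast
    then show "(e, e) \<in> q'"
      using q'_iff[of u u] refl_onD[OF q(2)] by blast
  qed
  moreover have "trans q'"
  proof (rule transI)
    fix e1 e2 e3 assume "(e1, e2) \<in> q'" "(e2, e3) \<in> q'"
    then obtain u v v' w where *: "e1 = f u" "e2 = f v" "e2 = f v'" "e3 = f w" "(u, v) \<in> q" "(v', w) \<in> q"
      and ran: "u \<in> range lam" "v \<in> range lam" "v' \<in> range lam" "w \<in> range lam"
      using q'_cases by metis
    then have "v = v'"
      using inj_onD[OF inj, of v v'] by simp
    then have "(u, w) \<in> q"
      using * transD[OF q(3)] by blast
    then show "(e1, e3) \<in> q'"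
      using * q'_iff[OF ran(1,4)] by simp
  qed
  moreover have "antisym q'"
  proof (rule antisymI)
    fix e1 e2 assume "(e1, e2) \<in> q'" and *: "(e2, e1) \<in> q'"
    then obtain u v where e: "e1 = f u" "e2 = f v" "(u, v) \<in> q" "u \<in> range lam" "v \<in> range lam"
      using q'_cases by metis
    then have "(v, u) \<in> q"
      using * q'_iff[of v u] by simp
    then show "e1 = e2"
      using e antisymD[OF q(4), of u v] by simp
  qed
  ultimately have po: "partial_order_on L' q'"
    by (auto simp: partial_order_on_def preorder_on_def)
  have word: "label_word mu xs = map f (label_word lam xs)" for xs
    by (simp add: label_word_def mu_def)
  have in_range: "set (label_word lam xs) \<subseteq> range lam" for xs
    unfolding label_word_def set_map by (rule image_mono) (rule subset_UNIV)
  have incr: "strictly_increasing q' (label_word mu xs) \<longleftrightarrow>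
      strictly_increasing q (label_word lam xs)" for xs
  proof -
    have "sorted_wrt (\<lambda>u v. (f u, f v) \<in> q' - Id) ws \<longleftrightarrow> sorted_wrt (\<lambda>u v. (u, v) \<in> q - Id) ws"
      if "set ws \<subseteq> range lam" for ws
      by (intro iffI; erule sorted_wrt_mono_rel[rotated]) (use that q'_Id in blast)+
    then show ?thesis
      using in_range by (simp only: strictly_increasing_def word sorted_wrt_map)
  qed
  have lex: "(label_word mu xs, label_word mu ys) \<in> lexord (q' - Id) \<longleftrightarrow>
      (label_word lam xs, label_word lam ys) \<in> lexord (q - Id)" for xs ys
    unfolding word
  proof (rule lexord_map_iff)
    have sub: "set (label_word lam xs) \<union> set (label_word lam ys) \<subseteq> range lam"
      using in_range by blast
    then show "inj_on f (set (label_word lam xs) \<union> set (label_word lam ys))"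
      by (rule inj_on_subset[OF inj])
    show "(f u, f v) \<in> q' - Id \<longleftrightarrow> (u, v) \<in> q - Id"
      if "u \<in> set (label_word lam xs) \<union> set (label_word lam ys)"
        "v \<in> set (label_word lam xs) \<union> set (label_word lam ys)" for u v
      by (rule q'_Id) (use that sub in blast)+
  qed
  have "mu \<in> covering_pairs r \<rightarrow> L'"
    using EL by (auto simp: EL_labeling_def mu_def L'_def)
  with EL po have "EL_labeling r L' q' mu"
    unfolding EL_labeling_def incr lex by (elim conjE, intro conjI)
  with assms(1) show ?thesis
    unfolding EL_shellable_def by blast
qed

section \<open>Adjoining a new top element\<close>

definition add_top :: "'a set \<Rightarrow> 'a option set" where
  "add_top P = insert None (Some ` P)"

definition add_top_rel :: "'a set \<Rightarrow> 'a rel \<Rightarrow> 'a option rel" where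
  "add_top_rel P r = {(Some x, Some y) | x y. (x, y) \<in> r} \<union> add_top P \<times> {None}"

section \<open>\<open>S\<close>-Dowling posets\<close>

definition right_mult_rel :: "('g, 'm) monoid_scheme \<Rightarrow> nat set \<Rightarrow> (nat \<Rightarrow> 'g) rel" where
  "right_mult_rel G B =
     {(b, b'). b \<in> B \<rightarrow>\<^sub>E carrier G \<and> b' \<in> B \<rightarrow>\<^sub>E carrier G \<and>
        (\<exists>g\<in>carrier G. \<forall>i\<in>B. b' i = b i \<otimes>\<^bsub>G\<^esub> g)}"

text \<open>
  A block \<open>(B, c)\<close> carries \<open>B\<close> explicitly: if \<open>undefined\<close> lies in \<open>G\<close>, the class \<open>c\<close> of
  extensional functions need not determine its domain.
\<close>

type_synonym 'g block = "nat set \<times> (nat \<Rightarrow> 'g) set"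

definition block :: "('g, 'm) monoid_scheme \<Rightarrow> nat set \<Rightarrow> (nat \<Rightarrow> 'g) \<Rightarrow> 'g block" where
  "block G B b = (B, right_mult_rel G B `` {b})"

definition partial_G_partition :: "nat \<Rightarrow> ('g, 'm) monoid_scheme \<Rightarrow> 'g block set \<Rightarrow> bool" where
  "partial_G_partition n G \<beta> \<longleftrightarrow>
     (\<Union>(B, c)\<in>\<beta>. B) \<subseteq> {1..n} \<and> partition_on (\<Union>(B, c)\<in>\<beta>. B) (fst ` \<beta>) \<and> inj_on fst \<beta> \<and>
     (\<forall>(B, c)\<in>\<beta>. c \<in> (B \<rightarrow>\<^sub>E carrier G) // right_mult_rel G B)"

definition zero_block :: "nat \<Rightarrow> 'g block set \<Rightarrow> nat set" where
  "zero_block n \<beta> = {1..n} - (\<Union>(B, c)\<in>\<beta>. B)"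

definition dowling :: "nat \<Rightarrow> ('g, 'm) monoid_scheme \<Rightarrow> 's set \<Rightarrow>
    ('g block set \<times> (nat \<Rightarrow> 's)) set" where
  "dowling n G S = {(\<beta>, z). partial_G_partition n G \<beta> \<and> z \<in> zero_block n \<beta> \<rightarrow>\<^sub>E S}"

inductive_set dowling_cover :: "nat \<Rightarrow> ('g, 'm) monoid_scheme \<Rightarrow> 's set \<Rightarrow> ('g \<Rightarrow> 's \<Rightarrow> 's) \<Rightarrow>
    ('g block set \<times> (nat \<Rightarrow> 's)) rel"
  for n :: nat and G :: "('g, 'm) monoid_scheme" and S :: "'s set" and act :: "'g \<Rightarrow> 's \<Rightarrow> 's"
  where
  merge: "\<lbrakk>(\<beta> \<union> {block G A a, block G B b}, z) \<in> dowling n G S;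
      (\<beta> \<union> {block G (A \<union> B) c}, z) \<in> dowling n G S;
      block G A a \<notin> \<beta>; block G B b \<notin> \<beta>; block G A a \<noteq> block G B b;
      a \<in> A \<rightarrow>\<^sub>E carrier G; b \<in> B \<rightarrow>\<^sub>E carrier G; c \<in> A \<union> B \<rightarrow>\<^sub>E carrier G;
      g \<in> carrier G; \<forall>i\<in>A. c i = a i; \<forall>i\<in>B. c i = b i \<otimes>\<^bsub>G\<^esub> g\<rbrakk>
    \<Longrightarrow> ((\<beta> \<union> {block G A a, block G B b}, z), (\<beta> \<union> {block G (A \<union> B) c}, z))
          \<in> dowling_cover n G S act"
| color: "\<lbrakk>(\<beta> \<union> {block G B b}, z) \<in> dowling n G S; (\<beta>, z') \<in> dowling n G S;
      block G B b \<notin> \<beta>; b \<in> B \<rightarrow>\<^sub>E carrier G;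
      \<forall>i\<in>zero_block n (\<beta> \<union> {block G B b}). z' i = z i;
      s \<in> S; \<forall>i\<in>B. z' i = act (b i) s\<rbrakk>
    \<Longrightarrow> ((\<beta> \<union> {block G B b}, z), (\<beta>, z')) \<in> dowling_cover n G S act"

definition dowling_le :: "nat \<Rightarrow> ('g, 'm) monoid_scheme \<Rightarrow> 's set \<Rightarrow> ('g \<Rightarrow> 's \<Rightarrow> 's) \<Rightarrow>
    ('g block set \<times> (nat \<Rightarrow> 's)) rel" where
  "dowling_le n G S act = (dowling_cover n G S act)\<^sup>* \<inter> dowling n G S \<times> dowling n G S"

end

theory Submission
  imports Defs "HOL-Library.Product_Lexorder"
begin

text \<open>
  Normalise every block \<open>B\<close> by \<open>b (Min B) = \<one>\<close>. An element of the Dowling poset then becomes a map sending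
  a point \<open>i\<close> either to \<open>u \<cdot> m\<close>, with \<open>u \<in> G\<close> and \<open>m\<close> the minimum (the root) of the block of \<open>i\<close>, or to a
  colour in \<open>S\<close>. Covering relations become substitutions \<open>m := e\<close> of one root, by \<open>g \<cdot> m'\<close> with a smaller
  root \<open>m'\<close> or by a colour, and \<open>x \<le> y\<close> holds iff applying \<open>y\<close> to the values of \<open>x\<close> gives back \<open>y\<close>.

  Fix a value \<open>e\<^sub>0\<close> that no substitution changes: a colour, or the point \<open>1\<close> if \<open>S\<close> is empty. Label the
  substitution \<open>m := e\<close> by \<open>(\<kappa>, m)\<close>, where \<open>\<kappa>\<close> is 0 if \<open>e = e\<^sub>0\<close>, 2 if \<open>e\<close> is another colour and 3 if \<open>e\<close>
  is another multiple of a root, label the edges to the new top by \<open>(1, 0)\<close>, and order the labels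
  lexicographically. In \<open>[x, y]\<close> the increasing chain substitutes \<open>m := y m\<close> for the roots \<open>m\<close> of \<open>x\<close> that
  are not roots of \<open>y\<close>, in the order of their labels; below the new top it substitutes \<open>m := e\<^sub>0\<close> for all
  roots other than \<open>e\<^sub>0\<close>, in increasing order.
\<close>

section \<open>A criterion for EL-labelings\<close>

lemma maximal_chain_refl:
  assumes "partial_order_on P r" "x \<in> P"
  shows "maximal_chain r x x xs \<longleftrightarrow> xs = [x]"
proof -
  have refl: "(x, x) \<in> r" and anti: "antisym r"
    using assms by (auto simp: partial_order_on_def preorder_on_def refl_on_def)
  have int: "interval r x x = {x}"
    using refl anti by (auto simp: interval_def antisym_def)
  show ?thesis
  proof
    assume "xs = [x]"
    then show "maximal_chain r x x xs"
      by (auto simp: maximal_chain_def int strictly_increasing_def)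
  next
    assume mc: "maximal_chain r x x xs"
    then have "set xs \<subseteq> {x}" and s: "strictly_increasing r xs"
      by (auto simp: maximal_chain_def int)
    moreover have "x \<in> set xs"
      using mc refl \<open>set xs \<subseteq> {x}\<close> unfolding maximal_chain_def int by blast
    ultimately obtain ys where xs: "xs = x # ys" "set ys \<subseteq> {x}"
      by (cases xs) auto
    then show "xs = [x]"
      using s by (cases ys) (auto simp: strictly_increasing_def)
  qed
qed

text \<open>The bottom \<open>x\<close> is comparable to the whole interval, so maximality puts it
  first in the chain. An element between \<open>x\<close> and the next entry is comparable to the
  whole chain as well, so that entry covers \<open>x\<close>. Chains can then be treated by
  recursion, without the maximality condition.\<close>

lemma maximal_chain_Cons:
  assumes po: "partial_order_on P r" and xy: "(x, y) \<in> r" "x \<noteq> y"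
  shows "maximal_chain r x y xs \<longleftrightarrow>
    (\<exists>a ys. xs = x # a # ys \<and> (x, a) \<in> covering_pairs r \<and> (a, y) \<in> r \<and> maximal_chain r a y (a # ys))"
proof -
  have anti: "\<And>u v. (u, v) \<in> r \<Longrightarrow> (v, u) \<in> r \<Longrightarrow> u = v"
    and tr: "\<And>u v w. (u, v) \<in> r \<Longrightarrow> (v, w) \<in> r \<Longrightarrow> (u, w) \<in> r"
    and dom: "r \<subseteq> P \<times> P"
    and refl: "\<And>u. u \<in> P \<Longrightarrow> (u, u) \<in> r"
    using po by (auto simp: partial_order_on_def preorder_on_def refl_on_def antisym_def trans_def)
  have rx: "(x, x) \<in> r" and ry: "(y, y) \<in> r"
    using refl dom xy by auto
  show ?thesis
  proof
    assume mc: "maximal_chain r x y xs"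
    have sub: "\<And>u. u \<in> set xs \<Longrightarrow> (x, u) \<in> r \<and> (u, y) \<in> r"
      and srt: "sorted_wrt (\<lambda>u v. (u, v) \<in> r - Id) xs"
      and mx: "\<And>w. (x, w) \<in> r \<Longrightarrow> (w, y) \<in> r \<Longrightarrow> (\<And>u. u \<in> set xs \<Longrightarrow> (u, w) \<in> r \<or> (w, u) \<in> r)
        \<Longrightarrow> w \<in> set xs"
      using mc by (auto simp: maximal_chain_def interval_def strictly_increasing_def)
    have xin: "x \<in> set xs" and yin: "y \<in> set xs"
      using mx sub rx ry xy(1) by blast+
    then obtain h t where xs: "xs = h # t" by (cases xs) auto
    have "h = x"
    proof (rule ccontr)
      assume "h \<noteq> x"
      then have "x \<in> set t" using xin xs by auto
      then have "(h, x) \<in> r" using srt xs by auto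
      moreover have "(x, h) \<in> r" using sub xs by auto
      ultimately show False using anti \<open>h \<noteq> x\<close> by blast
    qed
    then obtain a ys where t: "t = a # ys"
      using xs yin xy(2) by (cases t) auto
    have xs: "xs = x # a # ys" using xs t \<open>h = x\<close> by simp
    have srt': "(x, a) \<in> r" "x \<noteq> a" "\<And>u. u \<in> set ys \<Longrightarrow> (a, u) \<in> r \<and> a \<noteq> u"
      "\<And>u. u \<in> set ys \<Longrightarrow> x \<noteq> u"
      "sorted_wrt (\<lambda>u v. (u, v) \<in> r - Id) (a # ys)"
      using srt xs by auto
    have ay: "(a, y) \<in> r" using sub xs by auto
    have ra: "(a, a) \<in> r" using refl dom ay by auto
    have "w = x \<or> w = a" if w: "(x, w) \<in> r" "(w, a) \<in> r" for w
    proof -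
      have "w \<in> set xs"
      proof (rule mx[OF w(1) tr[OF w(2) ay]])
        fix u assume "u \<in> set xs"
        then show "(u, w) \<in> r \<or> (w, u) \<in> r"
          using xs w srt'(3) tr[OF w(2)] by auto
      qed
      then show ?thesis
        using xs srt'(3) w(2) anti by fastforce
    qed
    then have cov: "(x, a) \<in> covering_pairs r"
      using srt' rx ra by (auto simp: covering_pairs_def interval_def)
    have "maximal_chain r a y (a # ys)"
      unfolding maximal_chain_def strictly_increasing_def
    proof (intro conjI ballI impI)
      show "sorted_wrt (\<lambda>u v. (u, v) \<in> r - Id) (a # ys)" by fact
      show "set (a # ys) \<subseteq> interval r a y"
        using srt' sub xs ra ay by (auto simp: interval_def)
      fix w assume w: "w \<in> interval r a y" "\<forall>u\<in>set (a # ys). (u, w) \<in> r \<or> (w, u) \<in> r"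
      then have "w \<in> set xs"
        using xs tr[OF srt'(1)] by (intro mx) (auto simp: interval_def)
      moreover have "w \<noteq> x"
        using w(1) srt'(1,2) anti by (auto simp: interval_def)
      ultimately show "w \<in> set (a # ys)" using xs by auto
    qed
    then show "\<exists>a ys. xs = x # a # ys \<and> (x, a) \<in> covering_pairs r \<and> (a, y) \<in> r \<and> maximal_chain r a y (a # ys)"
      using xs cov ay by blast
  next
    assume "\<exists>a ys. xs = x # a # ys \<and> (x, a) \<in> covering_pairs r \<and> (a, y) \<in> r \<and> maximal_chain r a y (a # ys)"
    then obtain a ys where xs: "xs = x # a # ys" and cov: "(x, a) \<in> covering_pairs r"
      and ay: "(a, y) \<in> r" and mc: "maximal_chain r a y (a # ys)"
      by blast
    have xa: "(x, a) \<in> r" "x \<noteq> a" and cov': "\<And>w. (x, w) \<in> r \<Longrightarrow> (w, a) \<in> r \<Longrightarrow> w = x \<or> w = a"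
      using cov by (auto simp: covering_pairs_def interval_def)
    have sub: "\<And>u. u \<in> set (a # ys) \<Longrightarrow> (a, u) \<in> r \<and> (u, y) \<in> r"
      using mc by (auto simp: maximal_chain_def interval_def)
    have ne: "\<And>u. u \<in> set (a # ys) \<Longrightarrow> x \<noteq> u"
      using sub xa anti by blast
    show "maximal_chain r x y xs"
      unfolding maximal_chain_def strictly_increasing_def
    proof (intro conjI ballI impI)
      show "sorted_wrt (\<lambda>u v. (u, v) \<in> r - Id) xs"
        using mc sub ne tr[OF xa(1)]
        by (fastforce simp: xs maximal_chain_def strictly_increasing_def)
      show "set xs \<subseteq> interval r x y"
        using sub rx xy(1) tr[OF xa(1)] unfolding xs interval_def by fastforce
      fix w assume w: "w \<in> interval r x y" "\<forall>u\<in>set xs. (u, w) \<in> r \<or> (w, u) \<in> r"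
      then consider "(a, w) \<in> r" | "(w, a) \<in> r" using xs by auto
      then show "w \<in> set xs"
      proof cases
        case 1
        then have "w \<in> set (a # ys)"
          using mc w xs by (auto simp: maximal_chain_def interval_def)
        then show ?thesis using xs by auto
      next
        case 2
        then show ?thesis using cov'[of w] w xs by (auto simp: interval_def)
      qed
    qed
  qed
qed

lemma label_word_Cons_Cons [simp]:
  "label_word lam (x # a # ys) = lam (x, a) # label_word lam (a # ys)"
  by (simp add: label_word_def)

lemma label_word_single [simp]: "label_word lam [x] = []"
  by (simp add: label_word_def)

section \<open>From a condition on atoms to an EL-labeling\<close>

abbreviation le_rel :: "'l::linorder rel" where
  "le_rel \<equiv> {(u, v). u \<le> v}"

lemma strictly_increasing_le_rel: "strictly_increasing le_rel xs \<longleftrightarrow> sorted_wrt (<) xs"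
proof -
  have "(\<lambda>u v. (u, v) \<in> le_rel - Id) = ((<) :: 'a \<Rightarrow> 'a \<Rightarrow> bool)"
    by (auto simp: fun_eq_iff)
  then show ?thesis by (simp add: strictly_increasing_def)
qed

lemma le_rel_minus_Id: "le_rel - Id = {(u, v). u < v}"
  by auto

text \<open>The increasing chain takes the atom \<open>a\<close> and continues with the increasing
  chain of \<open>[a, y]\<close>; it stays increasing because all labels from \<open>a\<close>
  towards \<open>y\<close> exceed \<open>lam (x, a)\<close>. A chain through another atom has a
  larger first label, hence a later word. Induction is on \<open>rk\<close>.\<close>

lemma EL_labeling_by_atoms:
  fixes r :: "'a rel" and lam :: "'a \<times> 'a \<Rightarrow> 'l::linorder" and rk :: "'a \<Rightarrow> nat"
  assumes po: "partial_order_on P r"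
    and rk: "\<And>x y. (x, y) \<in> r \<Longrightarrow> x \<noteq> y \<Longrightarrow> rk y < rk x"
    and atoms: "\<And>x y. (x, y) \<in> r \<Longrightarrow> x \<noteq> y \<Longrightarrow>
      \<exists>a. (x, a) \<in> covering_pairs r \<and> (a, y) \<in> r \<and>
        (\<forall>c. (a, c) \<in> covering_pairs r \<and> (c, y) \<in> r \<longrightarrow> lam (x, a) < lam (a, c)) \<and>
        (\<forall>b. (x, b) \<in> covering_pairs r \<and> (b, y) \<in> r \<and> b \<noteq> a \<longrightarrow> lam (x, a) < lam (x, b) \<and>
          (\<exists>c. (b, c) \<in> covering_pairs r \<and> (c, y) \<in> r \<and> lam (b, c) \<le> lam (x, b)))"
  shows "EL_labeling r UNIV le_rel lam"
proof -
  have dom: "\<And>x y. (x, y) \<in> r \<Longrightarrow> x \<in> P \<and> y \<in> P"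
    using po by (auto simp: partial_order_on_def preorder_on_def)
  let ?cov = "covering_pairs r"
  let ?mc = "maximal_chain r" and ?w = "label_word lam"
  \<comment> \<open>The last conjunct, that the increasing chain starts with a least label, is what
    excludes increasing chains through other atoms. For \<open>x = y\<close> there are no atoms, so
    the unspecified \<open>hd []\<close> does no harm.\<close>
  have key: "\<exists>xs. ?mc x y xs \<and> sorted_wrt (<) (?w xs) \<and>
      (\<forall>ys. ?mc x y ys \<and> ys \<noteq> xs \<longrightarrow> \<not> sorted_wrt (<) (?w ys) \<and>
        (?w xs, ?w ys) \<in> lexord {(u, v). u < v}) \<and>
      (\<forall>c. (x, c) \<in> ?cov \<and> (c, y) \<in> r \<longrightarrow> lam (x, hd (tl xs)) \<le> lam (x, c))"
    if "(x, y) \<in> r" for x y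
    using that
  proof (induction "rk x" arbitrary: x rule: less_induct)
    case less
    show ?case
    proof (cases "x = y")
      case True
      have "x \<in> P" using dom less.prems by blast
      have "\<not> ((x, c) \<in> ?cov \<and> (c, y) \<in> r)" for c
        using po True
        by (auto simp: covering_pairs_def partial_order_on_def antisym_def)
      then show ?thesis
        using maximal_chain_refl[OF po \<open>x \<in> P\<close>] True by (intro exI[of _ "[x]"]) auto
    next
      case False
      note mcC = maximal_chain_Cons[OF po less.prems False]
      obtain a where a: "(x, a) \<in> ?cov" "(a, y) \<in> r"
        and up: "\<And>c. (a, c) \<in> ?cov \<Longrightarrow> (c, y) \<in> r \<Longrightarrow> lam (x, a) < lam (a, c)"
        and oth: "\<And>b. (x, b) \<in> ?cov \<Longrightarrow> (b, y) \<in> r \<Longrightarrow> b \<noteq> a \<Longrightarrow> lam (x, a) < lam (x, b) \<and>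
          (\<exists>c. (b, c) \<in> ?cov \<and> (c, y) \<in> r \<and> lam (b, c) \<le> lam (x, b))"
        using atoms[OF less.prems False] by blast
      have rk': "rk b < rk x" if "(x, b) \<in> ?cov" for b
        using that rk by (auto simp: covering_pairs_def)
      have start: "\<exists>zs. ys = b # zs \<and> (zs = [] \<longleftrightarrow> b = y) \<and>
          (zs \<noteq> [] \<longrightarrow> (b, hd zs) \<in> ?cov \<and> (hd zs, y) \<in> r)"
        if "?mc b y ys" "(b, y) \<in> r" for b ys
      proof (cases "b = y")
        case True
        then show ?thesis
          using that maximal_chain_refl[OF po, of b] dom by auto
      next
        case False
        then show ?thesis
          using that maximal_chain_Cons[OF po that(2) False] by auto
      qed
      obtain zs where zs: "?mc a y zs" "sorted_wrt (<) (?w zs)"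
        "\<And>ys. ?mc a y ys \<Longrightarrow> ys \<noteq> zs \<Longrightarrow> \<not> sorted_wrt (<) (?w ys) \<and>
          (?w zs, ?w ys) \<in> lexord {(u, v). u < v}"
        using less.hyps[OF rk'[OF a(1)] a(2)] by blast
      obtain zs' where zs': "zs = a # zs'" "zs' = [] \<longleftrightarrow> a = y"
          "zs' \<noteq> [] \<Longrightarrow> (a, hd zs') \<in> ?cov \<and> (hd zs', y) \<in> r"
        using start[OF zs(1) a(2)] by blast
      let ?xs = "x # zs"
      have 1: "?mc x y ?xs"
        using mcC zs(1) zs'(1) a by blast
      have 2: "sorted_wrt (<) (?w ?xs)"
      proof (cases zs')
        case Nil
        then show ?thesis using zs' by simp
      next
        case (Cons c cs)
        then have "lam (x, a) < lam (a, c)" using zs'(3) up by auto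
        then show ?thesis
          using zs(2) zs'(1) Cons by (auto simp: sorted_wrt2)
      qed
      have 3: "\<not> sorted_wrt (<) (?w ys) \<and> (?w ?xs, ?w ys) \<in> lexord {(u, v). u < v}"
        if ys: "?mc x y ys" "ys \<noteq> ?xs" for ys
      proof -
        obtain b ys' where b: "ys = x # b # ys'" "(x, b) \<in> ?cov" "(b, y) \<in> r" "?mc b y (b # ys')"
          using mcC ys(1) by blast
        show ?thesis
        proof (cases "b = a")
          case True
          then have "b # ys' \<noteq> zs" using b(1) ys(2) by simp
          then have "\<not> sorted_wrt (<) (?w (b # ys')) \<and> (?w zs, ?w (b # ys')) \<in> lexord {(u, v). u < v}"
            using zs(3) b(4) True by blast
          then show ?thesis
            using b(1) True zs'(1) by auto
        next
          case False
          obtain c where c: "(b, c) \<in> ?cov" "(c, y) \<in> r" "lam (b, c) \<le> lam (x, b)"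
            and ab: "lam (x, a) < lam (x, b)"
            using oth[OF b(2,3) False] by blast
          obtain us where us: "\<And>ys. ?mc b y ys \<Longrightarrow> ys \<noteq> us \<Longrightarrow> \<not> sorted_wrt (<) (?w ys)"
            "\<And>c. (b, c) \<in> ?cov \<Longrightarrow> (c, y) \<in> r \<Longrightarrow> lam (b, hd (tl us)) \<le> lam (b, c)"
            using less.hyps[OF rk'[OF b(2)] b(3)] by blast
          \<comment> \<open>If \<open>ys\<close> were increasing, its tail would be the increasing
            chain \<open>us\<close> of \<open>[b, y]\<close>, which starts with a least label. That
            label is at most \<open>lam (b, c)\<close>, hence at most
            \<open>lam (x, b)\<close>.\<close>
          have "\<not> sorted_wrt (<) (?w ys)"
          proof
            assume srt: "sorted_wrt (<) (?w ys)"
            then have "us = b # ys'" using us(1)[OF b(4)] b(1) by auto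
            moreover have "b \<noteq> y"
              using c po by (auto simp: covering_pairs_def partial_order_on_def antisym_def)
            then have "ys' \<noteq> []" using start[OF b(4,3)] by auto
            then obtain d ds where "ys' = d # ds" by (cases ys') auto
            ultimately have "lam (b, d) \<le> lam (x, b)"
              using us(2)[OF c(1,2)] c(3) by auto
            moreover have "lam (x, b) < lam (b, d)"
              using srt b(1) \<open>ys' = d # ds\<close> by simp
            ultimately show False by simp
          qed
          then show ?thesis using ab b(1) zs'(1) by auto
        qed
      qed
      have "lam (x, hd (tl ?xs)) \<le> lam (x, c)" if "(x, c) \<in> ?cov" "(c, y) \<in> r" for c
        using oth[OF that] zs'(1) by (cases "c = a") auto
      then show ?thesis using 1 2 3 by blast
    qed
  qed
  have main: "(\<exists>!xs. ?mc x y xs \<and> sorted_wrt (<) (?w xs)) \<and>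
      (\<forall>xs ys. ?mc x y xs \<and> sorted_wrt (<) (?w xs) \<and> ?mc x y ys \<and> ys \<noteq> xs \<longrightarrow>
         (?w xs, ?w ys) \<in> lexord {(u, v). u < v})" if "(x, y) \<in> r" for x y
    using key[OF that] by metis
  show ?thesis
    unfolding EL_labeling_def strictly_increasing_le_rel le_rel_minus_Id
  proof (intro conjI)
    show "partial_order_on UNIV (le_rel :: 'l rel)"
      by (auto simp: partial_order_on_def preorder_on_def refl_on_def trans_def antisym_def)
  qed (use main in fast)+
qed

section \<open>Posets of substitutions\<close>

text \<open>\<open>V\<close> is the set of points. The term \<open>Inl (m, u)\<close> stands for the
  formal product of \<open>u\<close> and the point \<open>m\<close>, and \<open>Inr s\<close> for
  the colour \<open>s\<close>.\<close>

locale term_action = group_action G S act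
  for G :: "('g, 'm) monoid_scheme" (structure) and S :: "'s set" and act +
  fixes V :: "nat set"
  assumes finite_V: "finite V" and V_nonempty: "V \<noteq> {}"
begin

sublocale group G
  using group_hom group_hom.axioms(1) by auto

definition scale :: "'g \<Rightarrow> nat \<times> 'g + 's \<Rightarrow> nat \<times> 'g + 's" where
  "scale u t = (case t of Inl (m, g) \<Rightarrow> Inl (m, u \<otimes> g) | Inr s \<Rightarrow> Inr (act u s))"

text \<open>The extension of \<open>h\<close> from points to terms that fixes the colours and
  commutes with scaling, as \<open>subst_scale\<close> confirms for normal \<open>h\<close>.\<close>

definition subst :: "(nat \<Rightarrow> nat \<times> 'g + 's) \<Rightarrow> nat \<times> 'g + 's \<Rightarrow> nat \<times> 'g + 's" where
  "subst h t = (case t of Inl (m, u) \<Rightarrow> scale u (h m) | Inr s \<Rightarrow> Inr s)"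

definition assign :: "nat \<Rightarrow> nat \<times> 'g + 's \<Rightarrow> nat \<Rightarrow> nat \<times> 'g + 's" where
  "assign m e i = (if i = m then e else Inl (i, \<one>))"

definition "terms" :: "(nat \<times> 'g + 's) set" where
  "terms = (V \<times> carrier G) <+> S"

text \<open>The last condition makes \<open>h\<close> idempotent as a substitution, and
  \<open>m \<le> i\<close> singles out the least point of each class as its root.\<close>

definition normal :: "(nat \<Rightarrow> nat \<times> 'g + 's) \<Rightarrow> bool" where
  "normal h \<longleftrightarrow> (\<forall>i\<in>V. h i \<in> terms \<and> (\<forall>m u. h i = Inl (m, u) \<longrightarrow> m \<le> i \<and> h m = Inl (m, \<one>)))"

definition roots :: "(nat \<Rightarrow> nat \<times> 'g + 's) \<Rightarrow> nat set" where
  "roots h = {m \<in> V. h m = Inl (m, \<one>)}"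

definition below :: "(nat \<Rightarrow> nat \<times> 'g + 's) \<Rightarrow> (nat \<Rightarrow> nat \<times> 'g + 's) \<Rightarrow> bool" where
  "below h k \<longleftrightarrow> (\<forall>i\<in>V. subst k (h i) = k i)"

text \<open>Only smaller roots are allowed as targets, so that the root of a merged class is again
  its least point.\<close>

definition legal :: "(nat \<Rightarrow> nat \<times> 'g + 's) \<Rightarrow> nat \<Rightarrow> nat \<times> 'g + 's \<Rightarrow> bool" where
  "legal h m e \<longleftrightarrow> m \<in> roots h \<and>
     ((\<exists>s\<in>S. e = Inr s) \<or> (\<exists>m'\<in>roots h. \<exists>g\<in>carrier G. m' < m \<and> e = Inl (m', g)))"

definition step :: "(nat \<Rightarrow> nat \<times> 'g + 's) \<Rightarrow> nat \<Rightarrow> nat \<times> 'g + 's \<Rightarrow> (nat \<Rightarrow> nat \<times> 'g + 's) \<Rightarrow> bool" where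
  "step h m e k \<longleftrightarrow> legal h m e \<and> (\<forall>i\<in>V. k i = subst (assign m e) (h i))"

lemma act_closed: "u \<in> carrier G \<Longrightarrow> s \<in> S \<Longrightarrow> act u s \<in> S"
  using element_image by blast

lemma act_one: "s \<in> S \<Longrightarrow> act \<one> s = s"
  using id_eq_one by (metis restrict_apply')

lemma scale_simps [simp]:
  "scale u (Inl (m, g)) = Inl (m, u \<otimes> g)" "scale u (Inr s) = Inr (act u s)"
  by (simp_all add: scale_def)

lemma subst_simps [simp]:
  "subst h (Inl (m, u)) = scale u (h m)" "subst h (Inr s) = Inr s"
  by (simp_all add: subst_def)

lemma assign_simps [simp]: "assign m e m = e" "i \<noteq> m \<Longrightarrow> assign m e i = Inl (i, \<one>)"
  by (simp_all add: assign_def)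

lemma terms_simps [simp]:
  "Inl (m, u) \<in> terms \<longleftrightarrow> m \<in> V \<and> u \<in> carrier G" "Inr s \<in> terms \<longleftrightarrow> s \<in> S"
  by (auto simp: terms_def)

lemma termsE:
  assumes "t \<in> terms"
  obtains m u where "t = Inl (m, u)" "m \<in> V" "u \<in> carrier G" | s where "t = Inr s" "s \<in> S"
  using assms by (auto simp: terms_def)

lemma scale_closed: "u \<in> carrier G \<Longrightarrow> t \<in> terms \<Longrightarrow> scale u t \<in> terms"
  by (auto elim!: termsE simp: act_closed)

lemma scale_scale: "u \<in> carrier G \<Longrightarrow> v \<in> carrier G \<Longrightarrow> t \<in> terms \<Longrightarrow>
    scale u (scale v t) = scale (u \<otimes> v) t"
  by (auto elim!: termsE simp: m_assoc composition_rule)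

lemma scale_one: "t \<in> terms \<Longrightarrow> scale \<one> t = t"
  by (auto elim!: termsE simp: act_one)

lemma normal_terms: "normal h \<Longrightarrow> i \<in> V \<Longrightarrow> h i \<in> terms"
  by (simp add: normal_def)

lemma normalD:
  assumes "normal h" "i \<in> V" "h i = Inl (m, u)"
  shows "m \<in> V" "u \<in> carrier G" "m \<le> i" "h m = Inl (m, \<one>)"
  using normal_terms[OF assms(1,2)] assms unfolding normal_def by (simp, simp, blast, blast)

lemma subst_scale:
  assumes "normal h" "u \<in> carrier G" "t \<in> terms"
  shows "subst h (scale u t) = scale u (subst h t)"
  using assms(3)
proof (cases rule: termsE)
  case (1 m v)
  then have "h m \<in> terms" using assms(1) normal_terms by blast
  then show ?thesis using 1 assms(2) by (simp add: scale_scale)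
qed simp

lemma normal_cases:
  assumes "normal h" "i \<in> V"
  obtains (root) m u where "h i = Inl (m, u)" "m \<in> roots h" "m \<in> V" "m \<le> i" "u \<in> carrier G" "h m = Inl (m, \<one>)"
    | (const) s where "h i = Inr s" "s \<in> S"
proof -
  have "h i \<in> terms" using assms normal_terms by blast
  then show thesis
  proof (cases rule: termsE)
    case (1 m u)
    then show thesis using normalD[OF assms] that(1)[of m u] by (simp add: roots_def)
  next
    case (2 s)
    then show thesis using that(2) by blast
  qed
qed

lemma rootsD: "m \<in> roots h \<Longrightarrow> m \<in> V \<and> h m = Inl (m, \<one>)"
  by (simp add: roots_def)

lemma finite_roots: "finite (roots h)"
  using finite_V by (simp add: roots_def)

section \<open>The order on normal substitutions\<close>

lemma below_refl: "normal h \<Longrightarrow> below h h"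
  unfolding below_def
proof
  fix i assume "normal h" "i \<in> V"
  then show "subst h (h i) = h i" by (cases rule: normal_cases) auto
qed

lemma belowD: "below h k \<Longrightarrow> i \<in> V \<Longrightarrow> subst k (h i) = k i"
  by (simp add: below_def)

lemma below_const: "below h k \<Longrightarrow> i \<in> V \<Longrightarrow> h i = Inr s \<Longrightarrow> k i = Inr s"
  using belowD[of h k i] by simp

text \<open>For \<open>h i = Inl (m, u)\<close> both sides become \<open>scale u (l m)\<close>,
  because \<open>subst l\<close> commutes with scaling.\<close>

lemma below_trans:
  assumes "normal h" "normal k" "normal l" "below h k" "below k l"
  shows "below h l"
  unfolding below_def
proof
  fix i assume i: "i \<in> V"
  from assms(1) i show "subst l (h i) = l i"
  proof (cases rule: normal_cases)
    case (root m u)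
    have "l i = subst l (scale u (k m))"
      using belowD[OF assms(4) i] belowD[OF assms(5) i] root by simp
    also have "\<dots> = scale u (subst l (k m))"
      using assms(2,3) root by (simp add: subst_scale normal_terms)
    also have "\<dots> = scale u (l m)"
      using assms(5) root by (simp add: below_def)
    finally show ?thesis using root by simp
  next
    case (const s)
    then have "l i = Inr s" using below_const assms(4,5) i by blast
    then show ?thesis using const by simp
  qed
qed

text \<open>Let \<open>h\<close> send \<open>m\<close> to a multiple of \<open>m'\<close>, so that
  \<open>m' \<le> m\<close>. Then \<open>k m'\<close> is a multiple of \<open>m\<close>, and
  normality of \<open>k\<close> gives \<open>m \<le> m'\<close>. Hence \<open>m = m'\<close> is a
  root of \<open>h\<close>.\<close>

lemma below_root:
  assumes "normal h" "normal k" "below h k" "i \<in> V" "k i = Inl (m, u)"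
  shows "m \<in> roots h"
proof -
  have m: "k m = Inl (m, \<one>)" "m \<in> V"
    using normalD[OF assms(2,4,5)] by auto
  from assms(1) m(2) show ?thesis
  proof (cases rule: normal_cases)
    case (root m' v)
    then have "scale v (k m') = Inl (m, \<one>)"
      using belowD[OF assms(3) m(2)] m(1) by simp
    then obtain w where "k m' = Inl (m, w)"
      by (cases "k m'") auto
    then have "m \<le> m'"
      using normalD(3)[OF assms(2)] root by blast
    then show ?thesis using root by simp
  next
    case (const s)
    then show ?thesis using below_const[OF assms(3) m(2)] m(1) by simp
  qed
qed

lemma roots_antimono:
  assumes "normal h" "normal k" "below h k"
  shows "roots k \<subseteq> roots h"
proof
  fix m assume "m \<in> roots k"
  then have "m \<in> V" "k m = Inl (m, \<one>)" using rootsD by auto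
  then show "m \<in> roots h" by (rule below_root[OF assms])
qed

text \<open>If \<open>k\<close> fixes all roots of \<open>h\<close>, then applying \<open>k\<close>
  changes no value of \<open>h\<close>.\<close>

lemma below_roots_eq:
  assumes "normal h" "below h k" "roots h \<subseteq> roots k" "i \<in> V"
  shows "h i = k i"
  using assms(1,4)
proof (cases rule: normal_cases)
  case (root m u)
  then have "k m = Inl (m, \<one>)" using assms(3) rootsD by blast
  then show ?thesis using root belowD[OF assms(2,4)] by simp
next
  case (const s)
  then show ?thesis using below_const[OF assms(2,4)] by simp
qed

section \<open>Substitution of a single root\<close>

lemma legal_terms: "legal h m e \<Longrightarrow> e \<in> terms"
  by (auto simp: legal_def roots_def)

lemma legal_neq: "legal h m e \<Longrightarrow> e \<noteq> Inl (m, g)"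
  by (auto simp: legal_def)

text \<open>The substitution affects only the multiples of \<open>m\<close>. They become colours or
  multiples of a smaller root, which is itself untouched; hence the result is normal and
  \<open>m\<close> is the only root lost.\<close>

lemma
  assumes st: "step h m e k" and h: "normal h"
  shows step_normal: "normal k" and step_roots: "roots k = roots h - {m}"
    and step_at: "k m = e" and step_below: "below h k"
proof -
  have leg: "legal h m e" and k: "\<And>i. i \<in> V \<Longrightarrow> k i = subst (assign m e) (h i)"
    using st by (auto simp: step_def)
  have m: "m \<in> V" "h m = Inl (m, \<one>)" using leg by (auto simp: legal_def roots_def)
  have e: "e \<in> terms" by (rule legal_terms[OF leg])
  show at: "k m = e" using k m e by (simp add: scale_one)
  have other: "k i = Inl (i, \<one>)" if "i \<in> roots h" "i \<noteq> m" for i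
    using k[of i] that by (auto simp: roots_def)
  \<comment> \<open>Scaling changes only the group element of an \<open>Inl\<close> term, so a
    multiple of \<open>e\<close> has the same root as \<open>e\<close>.\<close>
  have scale_e: "scale u e = Inl (p, v) \<Longrightarrow> p < m \<and> p \<in> roots h" if "u \<in> carrier G" for u p v
    using leg that by (auto simp: legal_def)
  have ki: "(h i = Inl (m, u) \<Longrightarrow> k i = scale u e)"
     "\<And>p. h i = Inl (p, u) \<Longrightarrow> p \<noteq> m \<Longrightarrow> k i = h i" "h i = Inr s \<Longrightarrow> k i = h i" if "i \<in> V" for i u s
  proof -
    show "h i = Inl (m, u) \<Longrightarrow> k i = scale u e" using k[OF that] by simp
    show "h i = Inr s \<Longrightarrow> k i = h i" using k[OF that] by simp
    show "k i = h i" if "h i = Inl (p, u)" "p \<noteq> m" for p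
    proof -
      have "u \<in> carrier G" using normalD(2)[OF h \<open>i \<in> V\<close> that(1)] .
      then show ?thesis using k[OF \<open>i \<in> V\<close>] that by simp
    qed
  qed
  show nk: "normal k"
    unfolding normal_def
  proof (intro ballI conjI allI impI)
    fix i assume i: "i \<in> V"
    show "k i \<in> terms"
      using h i
    proof (cases rule: normal_cases)
      case (root p u)
      then show ?thesis
        using ki[OF i] e h i scale_closed normal_terms by (cases "p = m") auto
    next
      case (const s)
      then show ?thesis using ki[OF i] by simp
    qed
    fix q v assume kq: "k i = Inl (q, v)"
    show "q \<le> i" "k q = Inl (q, \<one>)"
    proof -
      have "q \<le> i \<and> q \<in> roots h \<and> q \<noteq> m"
        using h i
      proof (cases rule: normal_cases)
        case (root p u)
        show ?thesis
        proof (cases "p = m")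
          case True
          then have "scale u e = Inl (q, v)" using ki(1)[OF i] root kq by simp
          then have "q < m \<and> q \<in> roots h" using scale_e root(5) by blast
          then show ?thesis using root(4) True by auto
        next
          case False
          then show ?thesis using ki(2)[OF i] root kq by auto
        qed
      next
        case (const s)
        then show ?thesis using ki(3)[OF i] kq by simp
      qed
      then show "q \<le> i" "k q = Inl (q, \<one>)" using other by auto
    qed
  qed
  show bel: "below h k"
    unfolding below_def
  proof
    fix i assume i: "i \<in> V"
    from h i show "subst k (h i) = k i"
    proof (cases rule: normal_cases)
      case (root p u)
      then show ?thesis
        using ki[OF i] at other[of p] by (cases "p = m") auto
    next
      case (const s)
      then show ?thesis using ki[OF i] by simp
    qed
  qed
  have "m \<notin> roots k" using at legal_neq[OF leg] by (auto simp: roots_def)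
  then show "roots k = roots h - {m}"
    using roots_antimono[OF h nk bel] rootsD[of _ h] other unfolding roots_def[of k] by blast
qed

text \<open>If \<open>k m\<close> is a multiple of a root of \<open>k\<close>, that root is also a
  root of \<open>h\<close> by \<open>below_root\<close>; it is at most \<open>m\<close> by normality
  and differs from \<open>m\<close>.\<close>

lemma legal_value:
  assumes "normal h" "normal k" "below h k" "m \<in> roots h" "m \<notin> roots k"
  shows "legal h m (k m)"
proof -
  have mV: "m \<in> V" using assms(4) rootsD by blast
  from assms(2) mV show ?thesis
  proof (cases rule: normal_cases)
    case (root p u)
    then have "p \<noteq> m" using assms(5) by auto
    then show ?thesis
      using root below_root[OF assms(1-3) mV] assms(4) by (force simp: legal_def)
  next
    case (const s)
    then show ?thesis using assms(4) by (auto simp: legal_def)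
  qed
qed

text \<open>The step changes \<open>h\<close> only at multiples of \<open>m\<close>, and
  \<open>subst k\<close> commutes with scaling, so the value at \<open>m\<close> alone decides. This
  describes the steps that stay inside an interval.\<close>

lemma step_below_iff:
  assumes "normal h" "normal k" "below h k" "step h m e a"
  shows "below a k \<longleftrightarrow> subst k e = k m"
proof
  have mV: "m \<in> V" using assms(4) rootsD unfolding step_def legal_def by blast
  show "subst k e = k m" if "below a k"
    using that step_at[OF assms(4,1)] mV unfolding below_def by metis
  assume e: "subst k e = k m"
  have et: "e \<in> terms" using assms(4) legal_terms by (auto simp: step_def)
  show "below a k"
    unfolding below_def
  proof
    fix i assume i: "i \<in> V"
    have ai: "a i = subst (assign m e) (h i)" using assms(4) i by (simp add: step_def)
    have hk: "subst k (h i) = k i" using assms(3) i by (simp add: below_def)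
    from assms(1) i show "subst k (a i) = k i"
    proof (cases rule: normal_cases)
      case (root p u)
      then show ?thesis
        using ai hk e et assms(2) by (cases "p = m") (auto simp: subst_scale)
    next
      case (const s)
      then have "k i = Inr s" using below_const assms(3) i by blast
      then show ?thesis using ai const by simp
    qed
  qed
qed

lemma subst_value:
  assumes "normal k" "i \<in> V"
  shows "subst k (k i) = k i"
  using below_refl[OF assms(1)] assms(2) by (simp add: below_def)

text \<open>The step \<open>m := k m\<close> leads to a substitution below \<open>k\<close> with the
  same roots as \<open>k\<close>, hence to \<open>k\<close> itself. To recognise a step it therefore
  suffices to check the order and to count roots.\<close>

lemma step_of_below:
  assumes "normal h" "normal k" "below h k" "m \<in> roots h" "roots k = roots h - {m}"
  shows "step h m (k m) k"
proof -
  define a where "a i = subst (assign m (k m)) (h i)" for i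
  have leg: "legal h m (k m)" using legal_value assms by blast
  then have st: "step h m (k m) a" by (simp add: step_def a_def)
  have mV: "m \<in> V" using assms(4) rootsD by blast
  have "below a k"
    using step_below_iff[OF assms(1-3) st] subst_value[OF assms(2) mV] by simp
  then have "a i = k i" if "i \<in> V" for i
    using below_roots_eq[OF step_normal[OF st assms(1)] _ _ that] step_roots[OF st assms(1)] assms(5)
    by blast
  then show ?thesis using leg by (simp add: step_def a_def)
qed

text \<open>This is \<open>e\<^sub>0\<close> of the introduction.\<close>

definition base :: "nat \<times> 'g + 's" where
  "base = (if S = {} then Inl (Min V, \<one>) else Inr (SOME s. s \<in> S))"

section \<open>Kinds of values, and the stability of the base value\<close>

text \<open>The number 1 is left free for the edges to the new top: they come after the
  substitutions of \<open>base\<close> and before all others.\<close>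

definition kind :: "nat \<times> 'g + 's \<Rightarrow> nat" where
  "kind t = (if t = base then 0 else case t of Inl _ \<Rightarrow> 3 | Inr _ \<Rightarrow> 2)"

lemma kind_le: "kind t \<le> 3"
  by (auto simp: kind_def split: sum.split)

lemma kind_cases: "t = base \<or> 2 \<le> kind t"
  by (auto simp: kind_def split: sum.split)

lemma kind_base [simp]: "kind base = 0"
  by (simp add: kind_def)

lemma Min_V: "Min V \<in> V" "i \<in> V \<Longrightarrow> Min V \<le> i"
  using finite_V V_nonempty by auto

text \<open>In this case there are no colours and \<open>base\<close> stands for the least point. A
  normal map sends that point to a multiple of a root not exceeding it, so the point is a root
  itself.\<close>

lemma base_root:
  assumes "normal k" "base = Inl (p, u)"
  shows "p \<in> roots k" "u = \<one>" "i \<in> V \<Longrightarrow> p \<le> i"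
proof -
  have b: "S = {}" "p = Min V" "u = \<one>"
    using assms(2) by (auto simp: base_def split: if_splits)
  from assms(1) Min_V(1) show "p \<in> roots k"
  proof (cases rule: normal_cases)
    case (root m v)
    then have "m = Min V" using Min_V(2)[of m] by simp
    then show ?thesis using root b by simp
  next
    case (const s)
    then show ?thesis using b by simp
  qed
  show "u = \<one>" "i \<in> V \<Longrightarrow> p \<le> i" using b Min_V by auto
qed

lemma base_const: "base = Inr s \<Longrightarrow> s \<in> S"
  by (auto simp: base_def some_in_eq split: if_splits)

lemma subst_base: "normal k \<Longrightarrow> subst k base = base"
  using base_root(1,2)[of k] rootsD[of _ k] by (cases base) auto

text \<open>A colour may always be substituted. If \<open>base\<close> stands for the least point,
  that point is a root of \<open>h\<close> and smaller than \<open>m\<close>.\<close>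

lemma legal_base:
  assumes "normal h" "m \<in> roots h" "base \<noteq> Inl (m, \<one>)"
  shows "legal h m base"
proof (cases base)
  case (Inl a)
  then obtain p u where b: "base = Inl (p, u)" by (cases a) auto
  have "p \<le> m" "u = \<one>" "p \<in> roots h"
    using base_root[OF assms(1) b] assms(2) by (auto simp: roots_def)
  then show ?thesis using b assms by (auto simp: legal_def)
next
  case (Inr s)
  then show ?thesis using assms(2) base_const by (auto simp: legal_def)
qed

end

section \<open>Posets whose elements are normal substitutions\<close>

text \<open>\<open>nf\<close> identifies \<open>P\<close> with the normal substitutions and
  \<open>cov\<close> with the single steps. Only values on \<open>V\<close> are compared, since
  substitutions are total functions on \<open>nat\<close>.\<close>

locale substitution_poset = term_action G S act V
  for G :: "('g, 'm) monoid_scheme" (structure) and S :: "'s set" and act and V +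
  fixes P :: "'a set" and cov :: "'a rel" and nf :: "'a \<Rightarrow> nat \<Rightarrow> nat \<times> 'g + 's"
  assumes nf_normal: "x \<in> P \<Longrightarrow> normal (nf x)"
    and nf_inj: "x \<in> P \<Longrightarrow> y \<in> P \<Longrightarrow> (\<And>i. i \<in> V \<Longrightarrow> nf x i = nf y i) \<Longrightarrow> x = y"
    and nf_surj: "normal h \<Longrightarrow> \<exists>x\<in>P. \<forall>i\<in>V. nf x i = h i"
    and cov_iff: "(x, y) \<in> cov \<longleftrightarrow> x \<in> P \<and> y \<in> P \<and> (\<exists>m e. step (nf x) m e (nf y))"
begin

definition le :: "'a rel" where
  "le = cov\<^sup>* \<inter> P \<times> P"

abbreviation Rt :: "'a \<Rightarrow> nat set" where
  "Rt x \<equiv> roots (nf x)"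

lemma step_exists:
  assumes "x \<in> P" "legal (nf x) m e"
  obtains y where "y \<in> P" "(x, y) \<in> cov" "step (nf x) m e (nf y)"
proof -
  let ?h = "\<lambda>i. subst (assign m e) (nf x i)"
  have st: "step (nf x) m e ?h" using assms(2) by (simp add: step_def)
  then have "normal ?h" using step_normal assms(1) nf_normal by blast
  then obtain y where y: "y \<in> P" "\<forall>i\<in>V. nf y i = ?h i" using nf_surj by blast
  then have "step (nf x) m e (nf y)" using assms(2) by (simp add: step_def)
  then show thesis using that y assms cov_iff by blast
qed

lemma step_unique:
  assumes "x \<in> P" "y \<in> P" "z \<in> P" "step (nf x) m e (nf y)" "step (nf x) m e (nf z)"
  shows "y = z"
  using assms by (intro nf_inj) (auto simp: step_def)

lemma below_eq:
  assumes "x \<in> P" "y \<in> P" "below (nf x) (nf y)" "Rt x \<subseteq> Rt y"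
  shows "x = y"
  using assms below_roots_eq nf_normal nf_inj by metis

text \<open>Any root that \<open>y\<close> lacks may be sent to its final value at once, without
  leaving the interval. This supplies the atoms used later.\<close>

lemma below_step:
  assumes "x \<in> P" "y \<in> P" "below (nf x) (nf y)" "m \<in> Rt x" "m \<notin> Rt y"
  obtains a where "a \<in> P" "(x, a) \<in> cov" "step (nf x) m (nf y m) (nf a)" "below (nf a) (nf y)"
proof -
  have leg: "legal (nf x) m (nf y m)"
    using legal_value assms nf_normal by blast
  have "m \<in> V" using assms(4) rootsD by blast
  obtain a where a: "a \<in> P" "(x, a) \<in> cov" "step (nf x) m (nf y m) (nf a)"
    using step_exists[OF assms(1) leg] by blast
  then have "below (nf a) (nf y)"
    using step_below_iff[OF nf_normal nf_normal] assms subst_value[OF nf_normal] \<open>m \<in> V\<close> by metis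
  then show thesis using that a by blast
qed

text \<open>Steps go up in the order \<open>below\<close>, which is transitive. Conversely, as long
  as \<open>x\<close> differs from \<open>y\<close> it has a root that \<open>y\<close> lacks, and
  \<open>below_step\<close> removes it; the induction is on the number of roots.\<close>

lemma le_iff: "(x, y) \<in> le \<longleftrightarrow> x \<in> P \<and> y \<in> P \<and> below (nf x) (nf y)"
proof
  assume "(x, y) \<in> le"
  then have "(x, y) \<in> cov\<^sup>*" "x \<in> P" "y \<in> P" by (auto simp: le_def)
  then have "y \<in> P \<and> below (nf x) (nf y)"
  proof (induction rule: rtrancl_induct)
    case base
    then show ?case using below_refl nf_normal by blast
  next
    case (step y z)
    then have yz: "y \<in> P" "z \<in> P" "below (nf y) (nf z)"
      using cov_iff step_below nf_normal by blast+
    then have "below (nf x) (nf y)" using step by blast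
    then show ?case using below_trans nf_normal yz step.prems by blast
  qed
  then show "x \<in> P \<and> y \<in> P \<and> below (nf x) (nf y)" using \<open>x \<in> P\<close> by blast
next
  assume "x \<in> P \<and> y \<in> P \<and> below (nf x) (nf y)"
  then show "(x, y) \<in> le"
  proof (induction "card (Rt x)" arbitrary: x rule: less_induct)
    case less
    then have xy: "x \<in> P" "y \<in> P" "below (nf x) (nf y)" by auto
    show ?case
    proof (cases "x = y")
      case True
      then show ?thesis using xy by (simp add: le_def)
    next
      case False
      then obtain m where m: "m \<in> Rt x" "m \<notin> Rt y" using below_eq xy by blast
      obtain a where a: "a \<in> P" "(x, a) \<in> cov" "step (nf x) m (nf y m) (nf a)" "below (nf a) (nf y)"
        using below_step[OF xy m] by blast
      have "Rt a = Rt x - {m}" using step_roots a xy nf_normal by blast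
      then have "card (Rt a) < card (Rt x)"
        using m finite_roots by (metis card_Diff1_less)
      then have "(a, y) \<in> le" using less a by blast
      then show ?thesis using a xy by (auto simp: le_def)
    qed
  qed
qed

lemma le_refl: "x \<in> P \<Longrightarrow> (x, x) \<in> le"
  by (simp add: le_def)

lemma partial_order_le: "partial_order_on P le"
proof -
  have "antisym le"
  proof (rule antisymI)
    fix x y assume "(x, y) \<in> le" "(y, x) \<in> le"
    then show "x = y" using below_eq roots_antimono nf_normal by (metis le_iff)
  qed
  moreover have "trans le"
    by (auto simp: trans_def le_def)
  ultimately show ?thesis
    by (auto simp: partial_order_on_def preorder_on_def refl_on_def le_def)
qed

lemma le_roots: "(x, y) \<in> le \<Longrightarrow> Rt y \<subseteq> Rt x"
  using le_iff roots_antimono nf_normal by blast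

lemma le_root_missing:
  assumes "(x, y) \<in> le" "x \<noteq> y"
  shows "\<exists>m. m \<in> Rt x \<and> m \<notin> Rt y"
  using assms below_eq le_iff by blast

lemma le_card: "(x, y) \<in> le \<Longrightarrow> x \<noteq> y \<Longrightarrow> card (Rt y) < card (Rt x)"
  using le_roots le_root_missing finite_roots by (metis psubset_card_mono psubsetI)

text \<open>A step loses exactly one root and every strict relation loses at least one, so nothing
  fits in between. For a covering pair, the atom from \<open>below_step\<close> must be
  \<open>y\<close>.\<close>

lemma covering_pairs_le: "covering_pairs le = cov"
proof (intro Set.set_eqI iffI; clarify)
  fix x y assume "(x, y) \<in> covering_pairs le"
  then have xy: "(x, y) \<in> le" "x \<noteq> y" and i: "interval le x y = {x, y}"
    by (auto simp: covering_pairs_def)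
  obtain m where m: "m \<in> Rt x" "m \<notin> Rt y" using le_root_missing[OF xy] by blast
  have xy': "x \<in> P" "y \<in> P" "below (nf x) (nf y)" using xy le_iff by auto
  obtain a where a: "a \<in> P" "(x, a) \<in> cov" "step (nf x) m (nf y m) (nf a)" "below (nf a) (nf y)"
    using below_step[OF xy' m] by blast
  have "a \<in> interval le x y"
    using a xy' le_iff step_below[OF a(3)] nf_normal by (simp add: interval_def)
  moreover have "a \<noteq> x"
    using step_roots[OF a(3)] nf_normal xy' m by auto
  ultimately show "(x, y) \<in> cov" using i a(2) by auto
next
  fix x y assume c: "(x, y) \<in> cov"
  then obtain m e where xy: "x \<in> P" "y \<in> P" and st: "step (nf x) m e (nf y)"
    using cov_iff by blast
  have m: "m \<in> Rt x" using st by (auto simp: step_def legal_def)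
  have r: "Rt y = Rt x - {m}" using step_roots st xy nf_normal by blast
  have le: "(x, y) \<in> le" using c xy by (auto simp: le_def)
  have "w = x \<or> w = y" if "(x, w) \<in> le" "(w, y) \<in> le" for w
  proof (rule ccontr)
    assume "\<not> (w = x \<or> w = y)"
    then have "card (Rt w) < card (Rt x)" "card (Rt y) < card (Rt w)"
      using that le_card by auto
    then show False using r m finite_roots[of "nf x"] by (simp add: card_Diff_singleton)
  qed
  then show "(x, y) \<in> covering_pairs le"
    using le xy r m le_refl by (auto simp: covering_pairs_def interval_def)
qed

section \<open>The edge labeling, and intervals inside the poset\<close>

text \<open>On a cover inside the poset, \<open>Rt x - Rt y\<close> consists of the substituted root
  only, and \<open>nf y m\<close> is the value put in its place.\<close>

definition edge_label :: "'a option \<times> 'a option \<Rightarrow> nat \<times> nat" where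
  "edge_label p = (case p of
     (Some x, Some y) \<Rightarrow> (let m = the_elem (Rt x - Rt y) in (kind (nf y m), m))
   | _ \<Rightarrow> (1, 0))"

lemma edge_label_top [simp]: "edge_label (Some x, None) = (1, 0)"
  by (simp add: edge_label_def)

lemma edge_label_step:
  assumes "x \<in> P" "y \<in> P" "step (nf x) m e (nf y)"
  shows "edge_label (Some x, Some y) = (kind e, m)"
proof -
  have "m \<in> Rt x" using assms by (auto simp: step_def legal_def)
  then have "Rt x - Rt y = {m}" using step_roots[OF assms(3)] assms nf_normal by auto
  then show ?thesis using step_at[OF assms(3)] assms nf_normal by (simp add: edge_label_def)
qed

text \<open>Staying below \<open>y\<close> means that \<open>subst (nf y) e\<close> is
  \<open>nf y m\<close>. If \<open>e\<close> is not this final value, then \<open>y\<close> moves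
  \<open>e\<close>; so \<open>e\<close> is neither a colour nor \<open>base\<close>, but a multiple
  of a smaller root that \<open>y\<close> removes. Detours therefore have the largest kind.\<close>

lemma step_kind_ge:
  assumes "x \<in> P" "b \<in> P" "y \<in> P" "step (nf x) m e (nf b)" "below (nf b) (nf y)"
  shows "kind (nf y m) \<le> kind e" "e \<noteq> nf y m \<Longrightarrow> kind e = 3"
    "e \<noteq> nf y m \<Longrightarrow> \<exists>m' g. m' < m \<and> e = Inl (m', g) \<and> m' \<in> Rt b \<and> m' \<notin> Rt y"
proof -
  have leg: "legal (nf x) m e" using assms by (simp add: step_def)
  then have mV: "m \<in> V" by (auto simp: legal_def roots_def)
  have e: "subst (nf y) e = nf y m"
    using assms mV step_at[OF assms(4) nf_normal[OF assms(1)]] by (auto simp: below_def)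
  have main: "kind e = 3 \<and> (\<exists>m' g. m' < m \<and> e = Inl (m', g) \<and> m' \<in> Rt b \<and> m' \<notin> Rt y)"
    if ne: "e \<noteq> nf y m"
  proof -
    have "e \<noteq> base" using subst_base[OF nf_normal[OF assms(3)]] e ne by auto
    moreover obtain m' g where m': "m' < m" "e = Inl (m', g)" "m' \<in> Rt x" "g \<in> carrier G"
      using leg e ne by (auto simp: legal_def)
    moreover have "m' \<notin> Rt y"
    proof
      assume "m' \<in> Rt y"
      then have "subst (nf y) e = e" using m' by (auto simp: roots_def)
      then show False using e ne by simp
    qed
    moreover have "m' \<in> Rt b"
      using m' step_roots[OF assms(4)] assms(1) nf_normal by auto
    ultimately show ?thesis by (auto simp: kind_def)
  qed
  then show "e \<noteq> nf y m \<Longrightarrow> kind e = 3"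
    "e \<noteq> nf y m \<Longrightarrow> \<exists>m' g. m' < m \<and> e = Inl (m', g) \<and> m' \<in> Rt b \<and> m' \<notin> Rt y" by auto
  show "kind (nf y m) \<le> kind e"
    using main kind_le by (cases "e = nf y m") auto
qed

lemma next_step:
  assumes "(b, y) \<in> le" "m \<in> Rt b" "m \<notin> Rt y"
  shows "\<exists>c. (b, c) \<in> cov \<and> (c, y) \<in> le \<and> edge_label (Some b, Some c) = (kind (nf y m), m)"
proof -
  have bly: "b \<in> P" "y \<in> P" "below (nf b) (nf y)" using assms(1) le_iff by auto
  obtain c where "c \<in> P" "(b, c) \<in> cov" "step (nf b) m (nf y m) (nf c)" "below (nf c) (nf y)"
    using below_step[OF bly assms(2,3)] by blast
  then show ?thesis using edge_label_step bly le_iff by blast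
qed

text \<open>The atom \<open>a\<close> gives its final value to the root \<open>m0\<close> whose
  label is least among the roots lost on the way to \<open>y\<close>. All later labels are at least
  those of direct substitutions at the remaining roots, hence larger. Any other atom leaves a
  substitution with a label at most its own still to be made: that of \<open>m0\<close>, or that of
  the smaller root used in a detour.\<close>

lemma lower_atoms:
  assumes xy: "(x, y) \<in> le" "x \<noteq> y"
  shows "\<exists>a. (x, a) \<in> cov \<and> (a, y) \<in> le \<and>
    (\<forall>c. (a, c) \<in> cov \<and> (c, y) \<in> le \<longrightarrow>
       edge_label (Some x, Some a) < edge_label (Some a, Some c)) \<and>
    (\<forall>b. (x, b) \<in> cov \<and> (b, y) \<in> le \<and> b \<noteq> a \<longrightarrow>
       edge_label (Some x, Some a) < edge_label (Some x, Some b) \<and>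
       (\<exists>c. (b, c) \<in> cov \<and> (c, y) \<in> le \<and>
          edge_label (Some b, Some c) \<le> edge_label (Some x, Some b)))"
proof -
  have P: "x \<in> P" "y \<in> P" "below (nf x) (nf y)" using xy le_iff by auto
  \<comment> \<open>\<open>f m\<close> is the label of the direct substitution of
    \<open>nf y m\<close> for \<open>m\<close>. Its second component makes \<open>f\<close>
    injective, so the minimum at \<open>m0\<close> is strict.\<close>
  define f where "f m = (kind (nf y m), m)" for m
  have fin: "finite (Rt x - Rt y)" "Rt x - Rt y \<noteq> {}"
    using le_root_missing[OF xy] finite_roots by auto
  define m0 where "m0 = arg_min_on f (Rt x - Rt y)"
  have m0: "m0 \<in> Rt x" "m0 \<notin> Rt y"
    using arg_min_if_finite(1)[OF fin, of f] by (auto simp: m0_def)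
  have min: "f m0 \<le> f k" if "k \<in> Rt x" "k \<notin> Rt y" for k
    using arg_min_least[OF fin, of k f] that by (simp add: m0_def)
  obtain a where a: "a \<in> P" "(x, a) \<in> cov" "step (nf x) m0 (nf y m0) (nf a)" "below (nf a) (nf y)"
    using below_step[OF P m0] by blast
  have la: "edge_label (Some x, Some a) = f m0"
    using edge_label_step a P by (simp add: f_def)
  have Ra: "Rt a = Rt x - {m0}" using step_roots a P nf_normal by blast
  have up: "f m0 < edge_label (Some a, Some c)" if c: "(a, c) \<in> cov" "(c, y) \<in> le" for c
  proof -
    obtain m e where st: "step (nf a) m e (nf c)" and cP: "c \<in> P" using c cov_iff by blast
    have m: "m \<in> Rt a" "m \<notin> Rt c"
      using st step_roots[OF st] nf_normal a by (auto simp: step_def legal_def)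
    then have "m \<in> Rt x" "m \<noteq> m0" "m \<notin> Rt y" using Ra le_roots[OF c(2)] by auto
    then have "f m0 \<le> f m" "f m0 \<noteq> f m" using min by (auto simp: f_def)
    moreover have "f m \<le> edge_label (Some a, Some c)"
      using edge_label_step[OF a(1) cP st] step_kind_ge(1)[OF a(1) cP P(2) st] c(2) le_iff
      by (auto simp: f_def)
    ultimately show ?thesis by (metis order.strict_trans2 le_neq_trans)
  qed
  have oth: "f m0 < edge_label (Some x, Some b) \<and>
       (\<exists>c. (b, c) \<in> cov \<and> (c, y) \<in> le \<and> edge_label (Some b, Some c) \<le> edge_label (Some x, Some b))"
    if b: "(x, b) \<in> cov" "(b, y) \<in> le" "b \<noteq> a" for b
  proof -
    obtain m e where st: "step (nf x) m e (nf b)" and bP: "b \<in> P" using b cov_iff by blast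
    have bly: "below (nf b) (nf y)" using b le_iff by auto
    have lb: "edge_label (Some x, Some b) = (kind e, m)" by (rule edge_label_step[OF P(1) bP st])
    have Rb: "Rt b = Rt x - {m}" using step_roots[OF st] nf_normal P by blast
    have m: "m \<in> Rt x" "m \<notin> Rt y"
      using st Rb le_roots[OF b(2)] by (auto simp: step_def legal_def)
    note ge = step_kind_ge[OF P(1) bP P(2) st bly]
    show ?thesis
    proof (cases "m = m0")
      case False
      have "f m0 \<le> f m" "f m0 \<noteq> f m" using min[OF m] False by (auto simp: f_def)
      moreover have "f m \<le> (kind e, m)" using ge(1) by (auto simp: f_def)
      ultimately have "f m0 < (kind e, m)" by (metis order.strict_trans2 le_neq_trans)
      moreover obtain c where "(b, c) \<in> cov" "(c, y) \<in> le" "edge_label (Some b, Some c) = f m0"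
        using next_step[OF b(2), of m0] m0 Rb False by (auto simp: f_def)
      ultimately show ?thesis using lb less_imp_le by auto
    next
      case True
      \<comment> \<open>Same root but a different atom: \<open>e\<close> is a multiple of a smaller
        root \<open>m'\<close> that \<open>y\<close> removes as well. The label of \<open>b\<close>
        starts with 3, and \<open>m' < m\<close> makes \<open>f m'\<close> smaller even if
        \<open>kind (nf y m')\<close> is 3 too.\<close>
      have "e \<noteq> nf y m" using step_unique[OF P(1) bP a(1)] st a(3) b(3) True by auto
      then obtain m' where m': "m' < m" "m' \<in> Rt b" "m' \<notin> Rt y" and k: "kind e = 3"
        using ge(2,3) by blast
      have "f m0 \<le> f m'" using min m' Rb by auto
      moreover have "f m' < (kind e, m)"
        using k m'(1) kind_le[of "nf y m'"] by (auto simp: f_def)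
      moreover obtain c where "(b, c) \<in> cov" "(c, y) \<in> le" "edge_label (Some b, Some c) = f m'"
        using next_step[OF b(2) m'(2,3)] by (auto simp: f_def)
      ultimately show ?thesis using lb order.strict_trans1 less_imp_le by fastforce
    qed
  qed
  show ?thesis
  proof (rule exI[of _ a], intro conjI allI impI)
    show "(x, a) \<in> cov" "(a, y) \<in> le" using a P le_iff by auto
  qed (use la up oth in auto)
qed

section \<open>Intervals that end at the new top\<close>

text \<open>The roots that can still be sent to \<open>base\<close>: all of them if there are
  colours, otherwise all but the least point.\<close>

definition free_roots :: "'a \<Rightarrow> nat set" where
  "free_roots x = {m \<in> Rt x. base \<noteq> Inl (m, \<one>)}"

text \<open>Sending a free root to \<open>base\<close> is a step. A root that is not free is the
  least point, with \<open>S\<close> empty; it has neither a colour nor a smaller root to go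
  to.\<close>

lemma cov_exists_iff: "x \<in> P \<Longrightarrow> (\<exists>y. (x, y) \<in> cov) \<longleftrightarrow> free_roots x \<noteq> {}"
proof
  assume x: "x \<in> P"
  assume "free_roots x \<noteq> {}"
  then obtain m where "m \<in> Rt x" "base \<noteq> Inl (m, \<one>)" by (auto simp: free_roots_def)
  then show "\<exists>y. (x, y) \<in> cov" using legal_base step_exists x nf_normal by metis
next
  assume x: "x \<in> P"
  assume "\<exists>y. (x, y) \<in> cov"
  then obtain m e where leg: "legal (nf x) m e" using cov_iff by (auto simp: step_def)
  have "base \<noteq> Inl (m, \<one>)"
  proof
    assume b: "base = Inl (m, \<one>)"
    then have "S = {}" by (auto simp: base_def split: if_splits)
    then obtain m' where "m' \<in> Rt x" "m' < m" using leg unfolding legal_def by blast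
    then show False using base_root(3)[OF nf_normal[OF x] b, of m'] by (auto simp: roots_def)
  qed
  then show "free_roots x \<noteq> {}" using leg by (auto simp: free_roots_def legal_def)
qed

lemma step_base:
  assumes "x \<in> P" "m \<in> free_roots x"
  obtains y where "y \<in> P" "(x, y) \<in> cov" "step (nf x) m base (nf y)"
    "edge_label (Some x, Some y) = (0, m)"
proof -
  have "legal (nf x) m base" using assms legal_base nf_normal by (auto simp: free_roots_def)
  then obtain y where "y \<in> P" "(x, y) \<in> cov" "step (nf x) m base (nf y)"
    using step_exists assms by blast
  moreover from this have "edge_label (Some x, Some y) = (0, m)"
    using edge_label_step[OF assms(1)] by simp
  ultimately show thesis by (rule that)
qed

text \<open>This separates the covers that come before the label \<open>(1, 0)\<close> of the edges
  to the new top from those that come after it.\<close>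

lemma cov_label_cases:
  assumes "(x, y) \<in> cov"
  obtains m where "m \<in> free_roots x" "Rt y = Rt x - {m}" "edge_label (Some x, Some y) = (0, m)"
      "step (nf x) m base (nf y)"
    | m where "m \<in> Rt x" "Rt y = Rt x - {m}" "(2, 0) \<le> edge_label (Some x, Some y)"
proof -
  obtain m e where xy: "x \<in> P" "y \<in> P" and st: "step (nf x) m e (nf y)"
    using assms cov_iff by blast
  have m: "m \<in> Rt x" using st by (auto simp: step_def legal_def)
  have r: "Rt y = Rt x - {m}" using step_roots st xy nf_normal by blast
  have l: "edge_label (Some x, Some y) = (kind e, m)" by (rule edge_label_step[OF xy st])
  show thesis
  proof (cases "e = base")
    case True
    have "legal (nf x) m e" using st by (simp add: step_def)
    then have "base \<noteq> Inl (m, \<one>)" using True legal_neq by blast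
    then have "m \<in> free_roots x" using m by (simp add: free_roots_def)
    then show thesis by (rule that(1)) (use r l st True in simp_all)
  next
    case False
    then have "2 \<le> kind e" using kind_cases by blast
    then have "(2, 0) \<le> edge_label (Some x, Some y)" using l by simp
    then show thesis by (rule that(2)[OF m r])
  qed
qed

abbreviation top_rel :: "'a option rel" where
  "top_rel \<equiv> add_top_rel P le"

lemma top_rel_simps:
  "(Some x, Some y) \<in> top_rel \<longleftrightarrow> (x, y) \<in> le"
  "(Some x, None) \<in> top_rel \<longleftrightarrow> x \<in> P"
  "(None, Some y) \<notin> top_rel"
  "(None, None) \<in> top_rel"
  by (auto simp: add_top_rel_def add_top_def)

lemma partial_order_top_rel: "partial_order_on (add_top P) top_rel"
proof -
  have anti: "antisym le" and tr: "trans le"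
    using partial_order_le by (auto simp: partial_order_on_def preorder_on_def)
  have sub: "top_rel \<subseteq> add_top P \<times> add_top P"
    by (auto simp: add_top_rel_def add_top_def le_def)
  have "antisym top_rel"
  proof (rule antisymI)
    fix p q assume "(p, q) \<in> top_rel" "(q, p) \<in> top_rel"
    then show "p = q"
      by (cases p; cases q) (auto simp: top_rel_simps dest: antisymD[OF anti])
  qed
  moreover have "trans top_rel"
  proof (rule transI)
    fix p q w assume pq: "(p, q) \<in> top_rel" and qw: "(q, w) \<in> top_rel"
    show "(p, w) \<in> top_rel"
    proof (cases w)
      case None
      then show ?thesis using pq sub by (auto simp: add_top_rel_def)
    next
      case (Some z)
      then obtain x y where "p = Some x" "q = Some y"
        using pq qw by (cases p; cases q) (auto simp: top_rel_simps)
      then show ?thesis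
        using pq qw Some transD[OF tr, of x y z] by (simp add: top_rel_simps)
    qed
  qed
  moreover have "refl_on (add_top P) top_rel"
    using le_refl by (auto simp: refl_on_def add_top_def top_rel_simps)
  ultimately show ?thesis
    using sub by (simp add: partial_order_on_def preorder_on_def)
qed

text \<open>The new top adds nothing to intervals that end inside the poset. It covers exactly the
  maximal elements, and an element that is not maximal has a cover because \<open>le\<close> is
  generated by \<open>cov\<close>.\<close>

lemma covering_pairs_top_rel:
  "(Some x, Some y) \<in> covering_pairs top_rel \<longleftrightarrow> (x, y) \<in> cov"
  "(Some x, None) \<in> covering_pairs top_rel \<longleftrightarrow> x \<in> P \<and> free_roots x = {}"
  "(None, z) \<notin> covering_pairs top_rel"
proof -
  have "interval top_rel (Some x) (Some y) = Some ` interval le x y"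
    (is "?L = ?R")
  proof (rule Set.set_eqI)
    fix w show "w \<in> ?L \<longleftrightarrow> w \<in> ?R"
      by (cases w) (auto simp: interval_def top_rel_simps)
  qed
  moreover have "Some ` A = {Some x, Some y} \<longleftrightarrow> A = {x, y}" for A
    using inj_image_eq_iff[of Some A "{x, y}"] by simp
  ultimately have "(Some x, Some y) \<in> covering_pairs top_rel \<longleftrightarrow> (x, y) \<in> covering_pairs le"
    by (simp add: covering_pairs_def top_rel_simps)
  then show "(Some x, Some y) \<in> covering_pairs top_rel \<longleftrightarrow> (x, y) \<in> cov"
    by (simp add: covering_pairs_le)
  show "(None, z) \<notin> covering_pairs top_rel"
    by (cases z) (auto simp: covering_pairs_def top_rel_simps)
  have int: "interval top_rel (Some x) None = insert None (Some ` {w. (x, w) \<in> le})"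
    (is "?L = ?R") if "x \<in> P"
  proof (rule Set.set_eqI)
    fix w show "w \<in> ?L \<longleftrightarrow> w \<in> ?R"
      using that by (cases w) (auto simp: interval_def top_rel_simps le_iff)
  qed
  have "{w. (x, w) \<in> le} = {x} \<longleftrightarrow> (\<nexists>y. (x, y) \<in> cov)" if x: "x \<in> P"
  proof
    assume "{w. (x, w) \<in> le} = {x}"
    then have "(x, y) \<notin> covering_pairs le" for y
      unfolding covering_pairs_def by auto
    then show "\<nexists>y. (x, y) \<in> cov"
      by (simp add: covering_pairs_le)
  next
    assume none: "\<nexists>y. (x, y) \<in> cov"
    have "w = x" if "(x, w) \<in> le" for w
    proof -
      have "(x, w) \<in> cov\<^sup>*" using that by (simp add: le_def)
      then show ?thesis by (cases rule: converse_rtranclE) (use none in auto)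
    qed
    then show "{w. (x, w) \<in> le} = {x}" using x le_refl by blast
  qed
  moreover have "insert None (Some ` A) = {Some x, None} \<longleftrightarrow> A = {x}" for A
    by auto
  ultimately show "(Some x, None) \<in> covering_pairs top_rel \<longleftrightarrow> x \<in> P \<and> free_roots x = {}"
    using cov_exists_iff[of x] int
    by (cases "x \<in> P") (simp_all add: covering_pairs_def top_rel_simps)
qed

text \<open>If no root is free, the only edge goes to the top. Otherwise \<open>a\<close> sends the
  least free root \<open>m0\<close> to \<open>base\<close>, with the least label
  \<open>(0, m0)\<close>. After another substitution of \<open>base\<close>, the root
  \<open>m0\<close> is still free and offers a smaller label; after any other step the label was at
  least \<open>(2, 0)\<close>, and the next edge can have label at most
  \<open>(1, 0)\<close>.\<close>

lemma upper_atoms: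
  assumes x: "x \<in> P"
  shows "\<exists>a. (Some x, a) \<in> covering_pairs top_rel \<and> (a, None) \<in> top_rel \<and>
    (\<forall>c. (a, c) \<in> covering_pairs top_rel \<and> (c, None) \<in> top_rel \<longrightarrow>
       edge_label (Some x, a) < edge_label (a, c)) \<and>
    (\<forall>b. (Some x, b) \<in> covering_pairs top_rel \<and> (b, None) \<in> top_rel \<and> b \<noteq> a \<longrightarrow>
       edge_label (Some x, a) < edge_label (Some x, b) \<and>
       (\<exists>c. (b, c) \<in> covering_pairs top_rel \<and> (c, None) \<in> top_rel \<and>
          edge_label (b, c) \<le> edge_label (Some x, b)))"
proof (cases "free_roots x = {}")
  case True
  then have "(Some x, Some b) \<notin> covering_pairs top_rel" for b
    using cov_exists_iff[OF x] covering_pairs_top_rel(1) by simp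
  moreover have "(Some x, None) \<in> covering_pairs top_rel"
    using True x covering_pairs_top_rel(2) by simp
  ultimately have "(Some x, b) \<in> covering_pairs top_rel \<longleftrightarrow> b = None" for b
    by (cases b) auto
  then show ?thesis
    by (intro exI[of _ None]) (simp add: covering_pairs_top_rel(3) top_rel_simps(4), metis option.exhaust)
next
  case False
  have fin: "finite (free_roots x)" using finite_roots by (simp add: free_roots_def)
  define m0 where "m0 = Min (free_roots x)"
  have m0: "m0 \<in> free_roots x" "\<And>m. m \<in> free_roots x \<Longrightarrow> m0 \<le> m"
    using fin False by (auto simp: m0_def)
  obtain a where a: "a \<in> P" "(x, a) \<in> cov" "step (nf x) m0 base (nf a)"
    and la: "edge_label (Some x, Some a) = (0, m0)"
    using step_base[OF x m0(1)] by blast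
  have Ra: "Rt a = Rt x - {m0}" using step_roots[OF a(3)] nf_normal x by blast
  have up: "(0, m0) < edge_label (Some a, c)" if "(Some a, c) \<in> covering_pairs top_rel" for c
  proof (cases c)
    case None
    then show ?thesis by simp
  next
    case (Some c')
    then have "(a, c') \<in> cov" using that covering_pairs_top_rel by simp
    then show ?thesis
    proof (cases rule: cov_label_cases)
      case (1 m)
      then have "m0 \<le> m" "m \<noteq> m0"
        using Ra m0(2) by (auto simp: free_roots_def)
      then show ?thesis using 1 Some by simp
    next
      case (2 m)
      then show ?thesis using Some order.strict_trans2[OF _ 2(3), of "(0, m0)"] by simp
    qed
  qed
  have oth: "(0, m0) < edge_label (Some x, b) \<and>
       (\<exists>c. (b, c) \<in> covering_pairs top_rel \<and> (c, None) \<in> top_rel \<and>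
          edge_label (b, c) \<le> edge_label (Some x, b))"
    if b: "(Some x, b) \<in> covering_pairs top_rel" "b \<noteq> Some a" for b
  proof -
    obtain b' where b': "b = Some b'" "(x, b') \<in> cov"
      using b False covering_pairs_top_rel by (cases b) auto
    then have bP: "b' \<in> P" using cov_iff by blast
    have low: "\<exists>c. (b, c) \<in> covering_pairs top_rel \<and> (c, None) \<in> top_rel \<and>
          edge_label (b, c) = (0, m)" if mf: "m \<in> free_roots b'" for m
    proof -
      obtain c where "c \<in> P" "(b', c) \<in> cov" "edge_label (Some b', Some c) = (0, m)"
        using step_base[OF bP mf] by blast
      then show ?thesis
        using b'(1) by (intro exI[of _ "Some c"]) (simp add: covering_pairs_top_rel top_rel_simps)
    qed
    from b'(2) show ?thesis
    proof (cases rule: cov_label_cases)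
      case (1 m)
      have "m \<noteq> m0" using step_unique[OF x bP a(1)] 1(4) a(3) b(2) b'(1) by auto
      then have "m0 < m" using m0(2)[OF 1(1)] by simp
      have "m0 \<in> free_roots b'" using \<open>m \<noteq> m0\<close> m0(1) 1(2) by (auto simp: free_roots_def)
      then obtain c where "(b, c) \<in> covering_pairs top_rel" "(c, None) \<in> top_rel" "edge_label (b, c) = (0, m0)"
        using low by blast
      then show ?thesis using \<open>m0 < m\<close> 1(3) b'(1) by auto
    next
      case (2 m)
      \<comment> \<open>Either a free root is left, with a label \<open>(0, k)\<close>, or the edge
        to the top is available, with label \<open>(1, 0)\<close>.\<close>
      have "\<exists>c. (b, c) \<in> covering_pairs top_rel \<and> (c, None) \<in> top_rel \<and> edge_label (b, c) \<le> (1, 0)"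
      proof (cases "free_roots b' = {}")
        case True
        then show ?thesis
          using b' bP by (intro exI[of _ None]) (auto simp: covering_pairs_top_rel top_rel_simps)
      next
        case False
        then obtain k where "k \<in> free_roots b'" by blast
        then obtain c where "(b, c) \<in> covering_pairs top_rel" "(c, None) \<in> top_rel"
            "edge_label (b, c) = (0, k)"
          using low by blast
        then show ?thesis by (intro exI[of _ c]) simp
      qed
      then obtain c where c: "(b, c) \<in> covering_pairs top_rel" "(c, None) \<in> top_rel" "edge_label (b, c) \<le> (1, 0)"
        by blast
      have l: "(1, 0) < edge_label (Some x, b)" "(0, m0) < edge_label (Some x, b)"
        using b'(1) order.strict_trans2[OF _ 2(3), of "(0, m0)"]
          order.strict_trans2[OF _ 2(3), of "(1, 0)"] by simp_all
      show ?thesis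
        using c(1,2) l(2) order.trans[OF c(3) less_imp_le[OF l(1)]] by blast
    qed
  qed
  show ?thesis
  proof (rule exI[of _ "Some a"], intro conjI allI impI)
    show "(Some x, Some a) \<in> covering_pairs top_rel" "(Some a, None) \<in> top_rel"
      using a(1,2) by (simp_all add: covering_pairs_top_rel top_rel_simps)
    show "edge_label (Some x, Some a) < edge_label (Some a, c)"
      if "(Some a, c) \<in> covering_pairs top_rel \<and> (c, None) \<in> top_rel" for c
      using up that la by simp
    fix b assume b: "(Some x, b) \<in> covering_pairs top_rel \<and> (b, None) \<in> top_rel \<and> b \<noteq> Some a"
    show "edge_label (Some x, Some a) < edge_label (Some x, b)"
      using oth[of b] b la by simp
    show "\<exists>c. (b, c) \<in> covering_pairs top_rel \<and> (c, None) \<in> top_rel \<and>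
        edge_label (b, c) \<le> edge_label (Some x, b)"
      using oth[of b] b by simp
  qed
qed

lemma bounded_top_rel: "bounded_poset (add_top P) top_rel"
proof -
  \<comment> \<open>The identity substitution, in which every point is a root, gives the
    bottom.\<close>
  have "normal (\<lambda>i. Inl (i, \<one>))" by (simp add: normal_def)
  then obtain b where b: "b \<in> P" "\<forall>i\<in>V. nf b i = Inl (i, \<one>)" using nf_surj by metis
  have "(b, x) \<in> le" if "x \<in> P" for x
    using that b nf_normal by (simp add: le_iff below_def scale_one normal_terms)
  then have "\<forall>x\<in>add_top P. (Some b, x) \<in> top_rel"
    using b by (auto simp: add_top_def top_rel_simps)
  moreover have "\<forall>x\<in>add_top P. (x, None) \<in> top_rel"
    by (auto simp: add_top_def top_rel_simps)
  ultimately show ?thesis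
    using partial_order_top_rel b(1) unfolding bounded_poset_def
    by (intro conjI bexI[of _ "Some b"] bexI[of _ None]) (simp_all add: add_top_def)
qed

theorem EL_shellable_top_rel: "EL_shellable (add_top P) top_rel"
proof (rule EL_shellableI[OF bounded_top_rel])
  \<comment> \<open>Roots are lost along every strict relation; \<open>Suc\<close> keeps the rank of
    an element without roots above that of the new top.\<close>
  define rk where "rk p = (case p of None \<Rightarrow> 0 | Some x \<Rightarrow> Suc (card (Rt x)))" for p
  show "EL_labeling top_rel UNIV le_rel edge_label"
  proof (rule EL_labeling_by_atoms[OF partial_order_top_rel, where rk = rk])
    fix p q assume pq: "(p, q) \<in> top_rel" "p \<noteq> q"
    then obtain x where p: "p = Some x" by (cases p; cases q) (auto simp: top_rel_simps)
    show "rk q < rk p"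
      using pq p le_card[of x] by (cases q) (auto simp: rk_def top_rel_simps)
    show "\<exists>a. (p, a) \<in> covering_pairs top_rel \<and> (a, q) \<in> top_rel \<and>
        (\<forall>c. (a, c) \<in> covering_pairs top_rel \<and> (c, q) \<in> top_rel \<longrightarrow>
           edge_label (p, a) < edge_label (a, c)) \<and>
        (\<forall>b. (p, b) \<in> covering_pairs top_rel \<and> (b, q) \<in> top_rel \<and> b \<noteq> a \<longrightarrow>
           edge_label (p, a) < edge_label (p, b) \<and>
          (\<exists>c. (b, c) \<in> covering_pairs top_rel \<and> (c, q) \<in> top_rel \<and>
             edge_label (b, c) \<le> edge_label (p, b)))"
    proof (cases q)
      case None
      then show ?thesis using upper_atoms[of x] pq p by (simp add: top_rel_simps)
    next
      case (Some y)
      \<comment> \<open>The new top does not lie below \<open>Some y\<close>, so the atoms and their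
        labels are those of \<open>le\<close>.\<close>
      have Some_cov: "(Some u, w) \<in> covering_pairs top_rel \<and> (w, q) \<in> top_rel \<longleftrightarrow>
          (\<exists>v. w = Some v \<and> (u, v) \<in> cov \<and> (v, y) \<in> le)" for u w
        using Some by (cases w) (auto simp: top_rel_simps covering_pairs_top_rel)
      have "(x, y) \<in> le" "x \<noteq> y" using pq p Some by (auto simp: top_rel_simps)
      from lower_atoms[OF this] obtain a where
        a: "(x, a) \<in> cov" "(a, y) \<in> le"
          "\<And>c. (a, c) \<in> cov \<Longrightarrow> (c, y) \<in> le \<Longrightarrow> edge_label (Some x, Some a) < edge_label (Some a, Some c)"
          "\<And>b. (x, b) \<in> cov \<Longrightarrow> (b, y) \<in> le \<Longrightarrow> b \<noteq> a \<Longrightarrow>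
            edge_label (Some x, Some a) < edge_label (Some x, Some b) \<and>
            (\<exists>c. (b, c) \<in> cov \<and> (c, y) \<in> le \<and> edge_label (Some b, Some c) \<le> edge_label (Some x, Some b))"
        by blast
      have "(p, Some a) \<in> covering_pairs top_rel \<and> (Some a, q) \<in> top_rel"
        using Some_cov[of x "Some a"] a(1,2) p by simp
      moreover have "edge_label (p, Some a) < edge_label (Some a, c)"
        if "(Some a, c) \<in> covering_pairs top_rel" "(c, q) \<in> top_rel" for c
        using Some_cov[of a c] that a(3) p by auto
      moreover have "edge_label (p, Some a) < edge_label (p, b) \<and>
          (\<exists>c. (b, c) \<in> covering_pairs top_rel \<and> (c, q) \<in> top_rel \<and>
             edge_label (b, c) \<le> edge_label (p, b))"
        if b: "(p, b) \<in> covering_pairs top_rel" "(b, q) \<in> top_rel" "b \<noteq> Some a" for b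
      proof -
        obtain v where v: "b = Some v" "(x, v) \<in> cov" "(v, y) \<in> le" "v \<noteq> a"
          using Some_cov[of x b] b p by blast
        then obtain w where w: "(v, w) \<in> cov" "(w, y) \<in> le"
            "edge_label (Some v, Some w) \<le> edge_label (Some x, Some v)"
          and "edge_label (Some x, Some a) < edge_label (Some x, Some v)"
          using a(4)[of v] by blast
        then show ?thesis using Some_cov[of v "Some w"] p v(1) by auto
      qed
      ultimately show ?thesis by blast
    qed
  qed
qed

end

section \<open>Normal forms of elements of the Dowling poset\<close>

lemma fst_block [simp]: "fst (block G B b) = B"
  by (simp add: block_def)

lemma PiE_const_mem: "b \<in> B \<rightarrow>\<^sub>E C \<Longrightarrow> i \<in> B \<Longrightarrow> b i \<in> C"
  by (rule PiE_mem)

context group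
begin

lemma mult_inv_cancel:
  assumes "g \<in> carrier G" "x \<in> carrier G"
  shows "g \<otimes> (inv g \<otimes> x) = x" "inv g \<otimes> (g \<otimes> x) = x"
  using assms by (simp_all flip: m_assoc)

lemma equiv_right_mult_rel: "equiv (B \<rightarrow>\<^sub>E carrier G) (right_mult_rel G B)"
proof (rule equivI)
  show "right_mult_rel G B \<subseteq> (B \<rightarrow>\<^sub>E carrier G) \<times> (B \<rightarrow>\<^sub>E carrier G)"
    by (auto simp: right_mult_rel_def)
  show "refl_on (B \<rightarrow>\<^sub>E carrier G) (right_mult_rel G B)"
  proof (rule refl_onI)
    fix b assume b: "b \<in> B \<rightarrow>\<^sub>E carrier G"
    then have "\<forall>i\<in>B. b i = b i \<otimes> \<one>" by (metis PiE_mem r_one)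
    then show "(b, b) \<in> right_mult_rel G B" using b by (auto simp: right_mult_rel_def)
  qed
  show "sym (right_mult_rel G B)"
  proof (rule symI)
    fix b b' assume "(b, b') \<in> right_mult_rel G B"
    then obtain g where "b \<in> B \<rightarrow>\<^sub>E carrier G" "b' \<in> B \<rightarrow>\<^sub>E carrier G" "g \<in> carrier G"
        "\<forall>i\<in>B. b' i = b i \<otimes> g"
      by (auto simp: right_mult_rel_def)
    moreover from this have "\<forall>i\<in>B. b i = b' i \<otimes> inv g"
      by (auto simp: m_assoc PiE_const_mem)
    ultimately show "(b', b) \<in> right_mult_rel G B"
      by (auto simp: right_mult_rel_def intro!: bexI[of _ "inv g"])
  qed
  show "trans (right_mult_rel G B)"
  proof (rule transI)
    fix b b' b'' assume "(b, b') \<in> right_mult_rel G B" "(b', b'') \<in> right_mult_rel G B"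
    then obtain g g' where *: "b \<in> B \<rightarrow>\<^sub>E carrier G" "b'' \<in> B \<rightarrow>\<^sub>E carrier G" "g \<in> carrier G" "g' \<in> carrier G"
        "\<forall>i\<in>B. b' i = b i \<otimes> g" "\<forall>i\<in>B. b'' i = b' i \<otimes> g'"
      by (auto simp: right_mult_rel_def)
    then have "\<forall>i\<in>B. b'' i = b i \<otimes> (g \<otimes> g')"
      by (auto simp: m_assoc PiE_const_mem)
    then show "(b, b'') \<in> right_mult_rel G B"
      using * by (auto simp: right_mult_rel_def intro!: bexI[of _ "g \<otimes> g'"])
  qed
qed

lemma block_eq_iff:
  assumes "b \<in> B \<rightarrow>\<^sub>E carrier G" "b' \<in> B \<rightarrow>\<^sub>E carrier G"
  shows "block G B b = block G B b' \<longleftrightarrow> (\<exists>g\<in>carrier G. \<forall>i\<in>B. b' i = b i \<otimes> g)"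
  using eq_equiv_class_iff[OF equiv_right_mult_rel assms] assms
  by (auto simp: block_def right_mult_rel_def)

text \<open>The common right factor cancels in the quotient. This makes the normal form independent
  of the representative.\<close>

lemma block_ratio:
  assumes "b \<in> B \<rightarrow>\<^sub>E carrier G" "b' \<in> B \<rightarrow>\<^sub>E carrier G" "block G B b = block G B b'" "i \<in> B" "j \<in> B"
  shows "b' i \<otimes> inv b' j = b i \<otimes> inv b j"
proof -
  obtain g where g: "g \<in> carrier G" "\<forall>i\<in>B. b' i = b i \<otimes> g"
    using block_eq_iff[OF assms(1,2)] assms(3) by auto
  have b: "b i \<in> carrier G" "b j \<in> carrier G" using assms by auto
  show ?thesis
    using g b assms(4,5) by (simp add: inv_mult_group m_assoc mult_inv_cancel)
qed

end

section \<open>The normal form of an element of the Dowling poset\<close>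

locale dowling_setup = group_action G S act
  for G :: "('g, 'm) monoid_scheme" (structure) and S :: "'s set" and act +
  fixes n :: nat
  assumes n_pos: "n > 0"
begin

definition pts :: "nat set" where
  "pts = {1..n}"

sublocale term_action G S act "pts"
  using n_pos by unfold_locales (auto simp: pts_def)

abbreviation D :: "('g block set \<times> (nat \<Rightarrow> 's)) set" where
  "D \<equiv> dowling n G S"

lemma dowling_block:
  assumes "(\<beta>, z) \<in> D" "p \<in> \<beta>"
  obtains B b where "p = block G B b" "b \<in> B \<rightarrow>\<^sub>E carrier G" "B \<noteq> {}" "B \<subseteq> pts" "finite B"
proof -
  obtain B c where p: "p = (B, c)" by (cases p)
  have part: "(\<Union>(B, c)\<in>\<beta>. B) \<subseteq> pts" "partition_on (\<Union>(B, c)\<in>\<beta>. B) (fst ` \<beta>)"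
    "\<forall>(B, c)\<in>\<beta>. c \<in> (B \<rightarrow>\<^sub>E carrier G) // right_mult_rel G B"
    using assms(1) by (auto simp: dowling_def partial_G_partition_def pts_def)
  have "B \<in> fst ` \<beta>" using assms(2) p by force
  then have "B \<noteq> {}" using part(2) by (auto simp: partition_on_def)
  have sub: "B \<subseteq> pts" using part(1) assms(2) p by blast
  have "c \<in> (B \<rightarrow>\<^sub>E carrier G) // right_mult_rel G B" using part(3) assms(2) p by blast
  then obtain b where "b \<in> B \<rightarrow>\<^sub>E carrier G" "c = right_mult_rel G B `` {b}"
    by (rule quotientE)
  then show thesis
    using that[of B b] p \<open>B \<noteq> {}\<close> sub finite_subset[OF sub finite_V] by (simp add: block_def)
qed

lemma dowling_block_set:
  assumes "(\<beta>, z) \<in> D" "block G B b \<in> \<beta>"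
  shows "B \<noteq> {}" "B \<subseteq> pts" "finite B"
proof -
  obtain B' b' where "block G B b = block G B' b'" "b' \<in> B' \<rightarrow>\<^sub>E carrier G"
      "B' \<noteq> {}" "B' \<subseteq> pts" "finite B'"
    by (rule dowling_block[OF assms])
  moreover from this(1) have "B = B'" by (simp add: block_def)
  ultimately show "B \<noteq> {}" "B \<subseteq> pts" "finite B" by auto
qed

lemma dowling_block_unique:
  assumes "(\<beta>, z) \<in> D" "p \<in> \<beta>" "q \<in> \<beta>" "i \<in> fst p" "i \<in> fst q"
  shows "p = q"
proof -
  have "disjoint (fst ` \<beta>)" "inj_on fst \<beta>"
    using assms(1) by (auto simp: dowling_def partial_G_partition_def partition_on_def)
  moreover have "fst p = fst q"
    using disjointD[OF calculation(1), of "fst p" "fst q"] assms(2-5) by auto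
  ultimately show ?thesis
    using assms(2,3) by (simp add: inj_on_def)
qed

lemma dowling_zero:
  assumes "(\<beta>, z) \<in> D"
  shows "z \<in> zero_block n \<beta> \<rightarrow>\<^sub>E S"
  using assms by (simp add: dowling_def)

lemma zero_block_iff: "i \<in> zero_block n \<beta> \<longleftrightarrow> i \<in> pts \<and> (\<forall>p\<in>\<beta>. i \<notin> fst p)"
  by (auto simp: zero_block_def pts_def)

text \<open>The \<open>Inl\<close> value is read off the representative that equals
  \<open>\<one>\<close> at \<open>Min B\<close>. It is well defined because blocks are disjoint and
  right multiplication cancels in the quotient, by \<open>block_ratio\<close>.\<close>

definition dnf :: "'g block set \<times> (nat \<Rightarrow> 's) \<Rightarrow> nat \<Rightarrow> nat \<times> 'g + 's" where
  "dnf x i = (if i \<in> zero_block n (fst x) then Inr (snd x i)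
     else (THE t. \<exists>B b. b \<in> B \<rightarrow>\<^sub>E carrier G \<and> block G B b \<in> fst x \<and> i \<in> B \<and>
       t = Inl (Min B, b i \<otimes> inv b (Min B))))"

lemma dnf_zero: "i \<in> zero_block n \<beta> \<Longrightarrow> dnf (\<beta>, z) i = Inr (z i)"
  by (simp add: dnf_def)

lemma dnf_block:
  assumes "(\<beta>, z) \<in> D" "block G B b \<in> \<beta>" "b \<in> B \<rightarrow>\<^sub>E carrier G" "i \<in> B"
  shows "dnf (\<beta>, z) i = Inl (Min B, b i \<otimes> inv b (Min B))"
proof -
  have "finite B" "B \<noteq> {}"
    using dowling_block_set[OF assms(1,2)] by auto
  then have Min: "Min B \<in> B" by simp
  have "(THE t. \<exists>B b. b \<in> B \<rightarrow>\<^sub>E carrier G \<and> block G B b \<in> \<beta> \<and> i \<in> B \<and>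
       t = Inl (Min B, b i \<otimes> inv b (Min B))) = (Inl (Min B, b i \<otimes> inv b (Min B)) :: nat \<times> 'g + 's)"
  proof (rule the_equality)
    show "\<exists>B' b'. b' \<in> B' \<rightarrow>\<^sub>E carrier G \<and> block G B' b' \<in> \<beta> \<and> i \<in> B' \<and>
       (Inl (Min B, b i \<otimes> inv b (Min B)) :: nat \<times> 'g + 's) = Inl (Min B', b' i \<otimes> inv b' (Min B'))"
      using assms by blast
    fix t :: "nat \<times> 'g + 's"
    assume "\<exists>B' b'. b' \<in> B' \<rightarrow>\<^sub>E carrier G \<and> block G B' b' \<in> \<beta> \<and> i \<in> B' \<and>
       t = Inl (Min B', b' i \<otimes> inv b' (Min B'))"
    then obtain B' b' where b': "b' \<in> B' \<rightarrow>\<^sub>E carrier G" "block G B' b' \<in> \<beta>" "i \<in> B'"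
       "t = Inl (Min B', b' i \<otimes> inv b' (Min B'))" by blast
    have eq: "block G B b = block G B' b'"
      using dowling_block_unique[OF assms(1,2) b'(2)] assms(4) b'(3) by simp
    then have "B' = B" by (simp add: block_def)
    then show "t = Inl (Min B, b i \<otimes> inv b (Min B))"
      using block_ratio[OF assms(3) _ _ assms(4) Min, of b'] b' eq by simp
  qed
  moreover have "i \<notin> zero_block n \<beta>"
    using assms(2,4) zero_block_iff[of i \<beta>] fst_block[of G B b] by blast
  ultimately show ?thesis by (simp add: dnf_def)
qed

lemma dowling_cases:
  assumes "(\<beta>, z) \<in> D" "i \<in> pts"
  obtains (zero) "i \<in> zero_block n \<beta>" "dnf (\<beta>, z) i = Inr (z i)" "z i \<in> S"
    | (blk) B b where "block G B b \<in> \<beta>" "b \<in> B \<rightarrow>\<^sub>E carrier G" "i \<in> B" "B \<subseteq> pts" "finite B"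
        "dnf (\<beta>, z) i = Inl (Min B, b i \<otimes> inv b (Min B))"
proof (cases "i \<in> zero_block n \<beta>")
  case True
  then show thesis using zero dnf_zero dowling_zero[OF assms(1)] by (auto simp: PiE_const_mem)
next
  case False
  then obtain p where p: "p \<in> \<beta>" "i \<in> fst p" using assms(2) by (auto simp: zero_block_iff)
  obtain B b where B: "p = block G B b" "b \<in> B \<rightarrow>\<^sub>E carrier G" "B \<noteq> {}" "B \<subseteq> pts" "finite B"
    by (rule dowling_block[OF assms(1) p(1)])
  then show thesis
    using blk[of B b] p dnf_block[OF assms(1)] by simp
qed

lemma dnf_Min:
  assumes "(\<beta>, z) \<in> D" "block G B b \<in> \<beta>" "b \<in> B \<rightarrow>\<^sub>E carrier G"
  shows "Min B \<in> B" "dnf (\<beta>, z) (Min B) = Inl (Min B, \<one>)"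
proof -
  have "finite B" "B \<noteq> {}"
    using dowling_block_set[OF assms(1,2)] by auto
  then show Min: "Min B \<in> B" by simp
  then have "b (Min B) \<in> carrier G" using assms(3) by auto
  then show "dnf (\<beta>, z) (Min B) = Inl (Min B, \<one>)"
    using dnf_block[OF assms Min] by simp
qed

lemma roots_dnf:
  assumes "(\<beta>, z) \<in> D"
  shows "roots (dnf (\<beta>, z)) = (\<lambda>p. Min (fst p)) ` \<beta>"
proof
  show "roots (dnf (\<beta>, z)) \<subseteq> (\<lambda>p. Min (fst p)) ` \<beta>"
  proof
    fix m assume "m \<in> roots (dnf (\<beta>, z))"
    then have m: "m \<in> pts" "dnf (\<beta>, z) m = Inl (m, \<one>)" using rootsD by auto
    from assms m(1) show "m \<in> (\<lambda>p. Min (fst p)) ` \<beta>"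
    proof (cases rule: dowling_cases)
      case zero
      then show ?thesis using m by simp
    next
      case (blk B b)
      then have "m = Min (fst (block G B b))" using m by simp
      then show ?thesis using blk(1) by blast
    qed
  qed
  show "(\<lambda>p. Min (fst p)) ` \<beta> \<subseteq> roots (dnf (\<beta>, z))"
  proof
    fix m assume "m \<in> (\<lambda>p. Min (fst p)) ` \<beta>"
    then obtain p where p: "p \<in> \<beta>" "m = Min (fst p)" by blast
    obtain B b where B: "p = block G B b" "b \<in> B \<rightarrow>\<^sub>E carrier G" "B \<noteq> {}" "B \<subseteq> pts" "finite B"
      by (rule dowling_block[OF assms p(1)])
    then show "m \<in> roots (dnf (\<beta>, z))"
      using dnf_Min[OF assms] p by (auto simp: roots_def)
  qed
qed

lemma normal_dnf:
  assumes "(\<beta>, z) \<in> D"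
  shows "normal (dnf (\<beta>, z))"
  unfolding normal_def
proof (intro ballI conjI allI impI)
  fix i assume i: "i \<in> pts"
  from assms i show "dnf (\<beta>, z) i \<in> terms"
  proof (cases rule: dowling_cases)
    case (blk B b)
    then have "Min B \<in> B" using dnf_Min[OF assms] by blast
    then have "Min B \<in> pts" "b i \<in> carrier G" "b (Min B) \<in> carrier G" using blk by auto
    then show ?thesis using blk(6) by simp
  qed simp
  fix m u assume m: "dnf (\<beta>, z) i = Inl (m, u)"
  from assms i have "m \<le> i \<and> dnf (\<beta>, z) m = Inl (m, \<one>)"
  proof (cases rule: dowling_cases)
    case (blk B b)
    then show ?thesis using m dnf_Min[OF assms blk(1,2)] by simp
  qed (use m in simp)
  then show "m \<le> i" "dnf (\<beta>, z) m = Inl (m, \<one>)" by auto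
qed

section \<open>The element of the Dowling poset with a given normal form\<close>

definition root_class :: "(nat \<Rightarrow> nat \<times> 'g + 's) \<Rightarrow> nat \<Rightarrow> nat set" where
  "root_class h m = {i \<in> pts. \<exists>u. h i = Inl (m, u)}"

definition twist :: "(nat \<Rightarrow> nat \<times> 'g + 's) \<Rightarrow> nat \<Rightarrow> nat \<Rightarrow> 'g" where
  "twist h m = (\<lambda>i\<in>root_class h m. snd (projl (h i)))"

definition root_block :: "(nat \<Rightarrow> nat \<times> 'g + 's) \<Rightarrow> nat \<Rightarrow> 'g block" where
  "root_block h m = block G (root_class h m) (twist h m)"

definition colours :: "(nat \<Rightarrow> nat \<times> 'g + 's) \<Rightarrow> nat \<Rightarrow> 's" where
  "colours h = (\<lambda>i\<in>{i \<in> pts. \<exists>s. h i = Inr s}. projr (h i))"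

text \<open>The inverse of \<open>dnf\<close>. For a root \<open>m\<close>, \<open>twist h m\<close>
  is the representative with value \<open>\<one>\<close> at \<open>m\<close>. Both
  \<open>twist\<close> and \<open>colours\<close> are restricted because blocks and colourings
  consist of extensional functions.\<close>

definition realize :: "(nat \<Rightarrow> nat \<times> 'g + 's) \<Rightarrow> 'g block set \<times> (nat \<Rightarrow> 's)" where
  "realize h = (root_block h ` roots h, colours h)"

lemma realize_cong: "(\<And>i. i \<in> pts \<Longrightarrow> h i = k i) \<Longrightarrow> realize h = realize k"
proof -
  assume eq: "\<And>i. i \<in> pts \<Longrightarrow> h i = k i"
  have c: "root_class h = root_class k"
    using eq by (auto simp: root_class_def fun_eq_iff)
  have "twist h m = twist k m" for m
    unfolding twist_def c by (rule restrict_ext) (auto simp: root_class_def eq)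
  then have "root_block h = root_block k" by (intro ext) (simp add: root_block_def c)
  moreover have "roots h = roots k" using eq by (auto simp: roots_def)
  moreover have "colours h = colours k"
    unfolding colours_def using eq by (auto simp: restrict_def fun_eq_iff)
  ultimately show ?thesis by (simp add: realize_def)
qed

lemma twist_PiE: "normal h \<Longrightarrow> twist h m \<in> root_class h m \<rightarrow>\<^sub>E carrier G"
  by (auto simp: twist_def root_class_def intro: normalD(2))

lemma twist_eq: "i \<in> pts \<Longrightarrow> h i = Inl (m, u) \<Longrightarrow> twist h m i = u"
  by (simp add: twist_def root_class_def)

lemma root_in_class: "m \<in> roots h \<Longrightarrow> m \<in> root_class h m"
  using rootsD[of m h] by (simp add: root_class_def)

lemma Min_root_class:
  assumes "normal h" "m \<in> roots h"
  shows "Min (root_class h m) = m"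
proof (rule Min_eqI)
  show "finite (root_class h m)" using finite_V by (simp add: root_class_def)
  show "m \<in> root_class h m" by (rule root_in_class[OF assms(2)])
  show "m \<le> i" if "i \<in> root_class h m" for i
    using that normalD(3)[OF assms(1)] by (auto simp: root_class_def)
qed

lemma zero_block_realize:
  assumes "normal h"
  shows "zero_block n (root_block h ` roots h) = {i \<in> pts. \<exists>s. h i = Inr s}"
proof (rule Set.set_eqI)
  fix i
  show "i \<in> zero_block n (root_block h ` roots h) \<longleftrightarrow> i \<in> {i \<in> pts. \<exists>s. h i = Inr s}"
  proof (cases "i \<in> pts")
    case True
    have z: "i \<in> zero_block n (root_block h ` roots h) \<longleftrightarrow> (\<forall>m\<in>roots h. i \<notin> root_class h m)"
      using True by (auto simp: zero_block_iff root_block_def)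
    from assms True show ?thesis
    proof (cases rule: normal_cases)
      case (root m u)
      then have "i \<in> root_class h m" using True by (simp add: root_class_def)
      then show ?thesis using z root by auto
    next
      case (const s)
      then show ?thesis using z True by (auto simp: root_class_def)
    qed
  qed (simp add: zero_block_iff)
qed

lemma realize_dowling:
  assumes "normal h"
  shows "realize h \<in> D"
proof -
  let ?\<beta> = "root_block h ` roots h"
  have U: "(\<Union>(B, c)\<in>?\<beta>. B) = (\<Union>m\<in>roots h. root_class h m)"
    by (auto simp: root_block_def block_def)
  have F: "fst ` ?\<beta> = root_class h ` roots h"
    by (simp add: image_image root_block_def)
  have disj: "m = m'" if "i \<in> root_class h m" "i \<in> root_class h m'" for i m m'
    using that by (auto simp: root_class_def)
  have "partition_on (\<Union>m\<in>roots h. root_class h m) (root_class h ` roots h)"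
    unfolding partition_on_def
  proof (intro conjI)
    show "disjoint (root_class h ` roots h)"
      using disj by (auto simp: disjoint_def)
    show "{} \<notin> root_class h ` roots h"
      using root_in_class by fastforce
  qed simp
  moreover have "inj_on fst ?\<beta>"
  proof (rule inj_onI)
    fix p q assume "p \<in> ?\<beta>" "q \<in> ?\<beta>" and eq: "fst p = fst q"
    then obtain m m' where m: "p = root_block h m" "q = root_block h m'" "m \<in> roots h" by auto
    then have "m \<in> root_class h m'" using root_in_class eq by (auto simp: root_block_def)
    then have "m = m'" using disj root_in_class m(3) by blast
    then show "p = q" using m by simp
  qed
  moreover have "(\<Union>m\<in>roots h. root_class h m) \<subseteq> pts"
    by (auto simp: root_class_def)
  moreover have "\<forall>(B, c)\<in>?\<beta>. c \<in> (B \<rightarrow>\<^sub>E carrier G) // right_mult_rel G B"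
    using twist_PiE[OF assms] by (auto simp: root_block_def block_def intro!: quotientI)
  ultimately have "partial_G_partition n G ?\<beta>"
    unfolding partial_G_partition_def U F pts_def[symmetric] by blast
  moreover have "projr (h i) \<in> S" if "i \<in> pts" "h i = Inr s" for i s
    using normal_terms[OF assms that(1)] that(2) by simp
  then have "colours h \<in> zero_block n ?\<beta> \<rightarrow>\<^sub>E S"
    unfolding zero_block_realize[OF assms] colours_def by (auto simp: restrict_PiE_iff)
  ultimately show ?thesis
    by (simp add: realize_def dowling_def)
qed

lemma dnf_realize:
  assumes "normal h" "i \<in> pts"
  shows "dnf (realize h) i = h i"
  using assms
proof (cases rule: normal_cases)
  case (root m u)
  have i: "i \<in> root_class h m" using root(1) assms(2) by (simp add: root_class_def)
  have "(root_block h ` roots h, colours h) \<in> D"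
    using realize_dowling[OF assms(1)] by (simp add: realize_def)
  then have "dnf (realize h) i = Inl (m, twist h m i \<otimes> inv (twist h m m))"
    unfolding realize_def
    using dnf_block[of _ _ "root_class h m" "twist h m" i] i root(2) twist_PiE[OF assms(1)]
      Min_root_class[OF assms(1) root(2)] by (simp add: root_block_def[symmetric])
  then show ?thesis
    using twist_eq root assms(2) by simp
next
  case (const s)
  then have "i \<in> zero_block n (root_block h ` roots h)"
    using zero_block_realize[OF assms(1)] assms(2) by blast
  then show ?thesis
    using const assms(2) by (simp add: realize_def dnf_zero colours_def)
qed

lemma realize_dnf:
  assumes "(\<beta>, z) \<in> D"
  shows "realize (dnf (\<beta>, z)) = (\<beta>, z)"
proof -
  let ?h = "dnf (\<beta>, z)"
  have nh: "normal ?h" by (rule normal_dnf[OF assms])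
  have blk: "root_block ?h (Min (fst p)) = p" if pb: "p \<in> \<beta>" for p
  proof -
    obtain B b where B: "p = block G B b" "b \<in> B \<rightarrow>\<^sub>E carrier G" "B \<noteq> {}" "B \<subseteq> pts" "finite B"
      by (rule dowling_block[OF assms pb])
    have p: "block G B b \<in> \<beta>" using pb B by simp
    have MinB: "Min B \<in> B" using dnf_Min[OF assms p B(2)] by simp
    have cl: "root_class ?h (Min B) = B"
    proof
      show "B \<subseteq> root_class ?h (Min B)"
        using dnf_block[OF assms p B(2)] B(4) by (auto simp: root_class_def)
      show "root_class ?h (Min B) \<subseteq> B"
      proof
        fix i assume "i \<in> root_class ?h (Min B)"
        then obtain u where i: "i \<in> pts" "?h i = Inl (Min B, u)" by (auto simp: root_class_def)
        from assms i(1) show "i \<in> B"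
        proof (cases rule: dowling_cases)
          case zero
          then show ?thesis using i by simp
        next
          case (blk B' b')
          then have "Min B' = Min B" using i by simp
          then have "Min B \<in> B'" using dnf_Min(1)[OF assms blk(1,2)] by simp
          then have "block G B' b' = block G B b"
            using dowling_block_unique[OF assms blk(1) p] MinB by simp
          then show ?thesis using blk(3) by (metis fst_block)
        qed
      qed
    qed
    have tw: "twist ?h (Min B) i = b i \<otimes> inv b (Min B)" if "i \<in> B" for i
      using twist_eq[of i ?h] dnf_block[OF assms p B(2) that] that B(4) by blast
    \<comment> \<open>The two representatives differ by the right factor
      \<open>inv b (Min B)\<close>.\<close>
    have "block G B b = block G B (twist ?h (Min B))"
      using block_eq_iff[OF B(2)] twist_PiE[OF nh, of "Min B"] tw MinB B(2)
      unfolding cl by (metis PiE_mem inv_closed)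
    then show ?thesis by (simp add: root_block_def cl B(1))
  qed
  have \<beta>: "root_block ?h ` roots ?h = \<beta>"
    using blk by (simp add: roots_dnf[OF assms] image_image)
  have "colours ?h = (\<lambda>i\<in>zero_block n \<beta>. projr (?h i))"
    unfolding colours_def zero_block_realize[OF nh, symmetric] \<beta> ..
  also have "\<dots> = restrict z (zero_block n \<beta>)"
    by (rule restrict_ext) (simp add: dnf_zero)
  also have "\<dots> = z"
    using dowling_zero[OF assms] by (rule PiE_restrict)
  finally show ?thesis using \<beta> by (simp add: realize_def)
qed

lemma dnf_inj:
  assumes "x \<in> D" "y \<in> D" "\<And>i. i \<in> pts \<Longrightarrow> dnf x i = dnf y i"
  shows "x = y"
  using realize_dnf[of "fst x" "snd x"] realize_dnf[of "fst y" "snd y"]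
    realize_cong[OF assms(3)] assms(1,2) by simp

section \<open>Covering relations as single substitutions\<close>

text \<open>These are the hypotheses of \<open>step_of_below\<close>, so the substituted value need
  not be computed. A merge loses the larger of two minima as a root, a colouring the minimum of the
  coloured block.\<close>

lemma cover_below:
  assumes "(x, y) \<in> dowling_cover n G S act"
  shows "x \<in> D \<and> y \<in> D \<and> below (dnf x) (dnf y) \<and>
    (\<exists>m\<in>roots (dnf x). roots (dnf y) = roots (dnf x) - {m})"
proof -
  have "((fst x, snd x), (fst y, snd y)) \<in> dowling_cover n G S act" using assms by simp
  then show ?thesis
  proof (cases (no_simp) rule: dowling_cover.cases)
    case (merge \<beta> A a B b z c g)
    let ?\<beta> = "\<beta> \<union> {block G A a, block G B b}" and ?\<gamma> = "\<beta> \<union> {block G (A \<union> B) c}"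
    have x: "(?\<beta>, z) \<in> D" and y: "(?\<gamma>, z) \<in> D" using merge by auto
    have A: "block G A a \<in> ?\<beta>" and B: "block G B b \<in> ?\<beta>" and C: "block G (A \<union> B) c \<in> ?\<gamma>" by auto
    define \<mu> where "\<mu> = Min (A \<union> B)"
    have kC: "dnf (?\<gamma>, z) i = Inl (\<mu>, c i \<otimes> inv c \<mu>)" if "i \<in> A \<union> B" for i
      unfolding \<mu>_def by (rule dnf_block[OF y C \<open>c \<in> A \<union> B \<rightarrow>\<^sub>E carrier G\<close> that])
    have MinA: "Min A \<in> A" and MinB: "Min B \<in> B" and MinC: "\<mu> \<in> A \<union> B"
      using dnf_Min(1)[OF x A] dnf_Min(1)[OF x B] dnf_Min(1)[OF y C] merge by (auto simp: \<mu>_def)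
    have cl: "\<And>i. i \<in> A \<Longrightarrow> a i \<in> carrier G" "\<And>i. i \<in> B \<Longrightarrow> b i \<in> carrier G"
      "\<And>i. i \<in> A \<union> B \<Longrightarrow> c i \<in> carrier G"
      using merge PiE_const_mem by fast+
    have g: "g \<in> carrier G" by fact
    have ca: "\<And>i. i \<in> A \<Longrightarrow> c i = a i" and cb: "\<And>i. i \<in> B \<Longrightarrow> c i = b i \<otimes> g"
      using merge by auto
    have below: "below (dnf (?\<beta>, z)) (dnf (?\<gamma>, z))"
      unfolding below_def
    proof
      fix i assume "i \<in> pts"
      with x show "subst (dnf (?\<gamma>, z)) (dnf (?\<beta>, z) i) = dnf (?\<gamma>, z) i"
      proof (cases rule: dowling_cases)
        case zero
        then have "i \<in> zero_block n ?\<gamma>" by (simp add: zero_block_iff)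
        then show ?thesis using zero(2) by (simp add: dnf_zero)
      next
        case (blk E e)
        then consider "block G E e \<in> \<beta>" | "block G E e = block G A a" | "block G E e = block G B b" by auto
        then show ?thesis
        proof cases
          case 1
          then have E: "block G E e \<in> ?\<gamma>" by simp
          have "e i \<in> carrier G" "e (Min E) \<in> carrier G"
            using blk(2,3) dnf_Min(1)[OF x blk(1,2)] by (auto intro: PiE_const_mem)
          then show ?thesis
            using blk(6) dnf_block[OF y E blk(2,3)] dnf_Min(2)[OF y E blk(2)] by simp
        next
          case 2
          then have "i \<in> A" using blk(3) by (simp add: block_def)
          then have h: "dnf (?\<beta>, z) i = Inl (Min A, a i \<otimes> inv a (Min A))"
            using dnf_block[OF x A] merge by blast
          have "a i \<otimes> inv a (Min A) \<otimes> (c (Min A) \<otimes> inv c \<mu>) = c i \<otimes> inv c \<mu>"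
            using cl \<open>i \<in> A\<close> MinA MinC by (simp add: ca m_assoc mult_inv_cancel)
          then show ?thesis using h kC[of i] kC[of "Min A"] \<open>i \<in> A\<close> MinA by simp
        next
          case 3
          then have "i \<in> B" using blk(3) by (simp add: block_def)
          then have h: "dnf (?\<beta>, z) i = Inl (Min B, b i \<otimes> inv b (Min B))"
            using dnf_block[OF x B] merge by blast
          \<comment> \<open>Since \<open>c\<close> is \<open>b\<close> times \<open>g\<close> on
            \<open>B\<close>, the factor \<open>inv b (Min B)\<close> cancels against
            \<open>c (Min B)\<close> and leaves \<open>b i \<otimes> g\<close>, which is
            \<open>c i\<close>.\<close>
          have "b i \<otimes> inv b (Min B) \<otimes> (c (Min B) \<otimes> inv c \<mu>) = c i \<otimes> inv c \<mu>"
            using cl \<open>i \<in> B\<close> MinB MinC g by (simp add: cb m_assoc mult_inv_cancel)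
          then show ?thesis using h kC[of i] kC[of "Min B"] \<open>i \<in> B\<close> MinB by simp
        qed
      qed
    qed
    have fin: "finite A" "finite B" "A \<noteq> {}" "B \<noteq> {}"
      using dowling_block_set[OF x A] dowling_block_set[OF x B] by auto
    have Min_inj: "p = q" if pq: "p \<in> ?\<beta>" "q \<in> ?\<beta>" "Min (fst p) = Min (fst q)" for p q
    proof -
      have "Min (fst p) \<in> fst p" "Min (fst q) \<in> fst q"
        using dowling_block[OF x pq(1)] dowling_block[OF x pq(2)] by (metis Min_in fst_block)+
      then show ?thesis using dowling_block_unique[OF x pq(1,2)] pq(3) by metis
    qed
    have ne: "Min A \<noteq> Min B" using Min_inj[OF A B] merge by auto
    define R where "R = (\<lambda>p. Min (fst p)) ` \<beta>"
    have notin: "Min A \<notin> R" "Min B \<notin> R"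
      using Min_inj[OF A] Min_inj[OF B] merge(7,8) unfolding R_def by force+
    have rx: "roots (dnf (?\<beta>, z)) = R \<union> {Min A, Min B}"
      unfolding roots_dnf[OF x] R_def by auto
    have ry: "roots (dnf (?\<gamma>, z)) = R \<union> {min (Min A) (Min B)}"
      unfolding roots_dnf[OF y] R_def using fin by (simp add: Min_Un)
    \<comment> \<open>The minimum of \<open>A \<union> B\<close> is the smaller of the two minima;
      the larger one stops being a root.\<close>
    have "max (Min A) (Min B) \<in> roots (dnf (?\<beta>, z))"
      unfolding rx by (simp add: max_def)
    moreover have "roots (dnf (?\<gamma>, z)) = roots (dnf (?\<beta>, z)) - {max (Min A) (Min B)}"
      unfolding rx ry using ne notin by (auto simp: max_def min_def)
    ultimately have "(?\<beta>, z) \<in> D \<and> (?\<gamma>, z) \<in> D \<and> below (dnf (?\<beta>, z)) (dnf (?\<gamma>, z)) \<and>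
      (\<exists>m\<in>roots (dnf (?\<beta>, z)). roots (dnf (?\<gamma>, z)) = roots (dnf (?\<beta>, z)) - {m})"
      using x y below by blast
    moreover have "x = (?\<beta>, z)" "y = (?\<gamma>, z)" using merge(1-4) by (simp_all add: prod_eq_iff)
    ultimately show ?thesis by simp
  next
    case (color \<beta> B b z z' s)
    let ?\<beta> = "\<beta> \<union> {block G B b}"
    have x: "(?\<beta>, z) \<in> D" and y: "(\<beta>, z') \<in> D" using color by auto
    have B: "block G B b \<in> ?\<beta>" by auto
    have b: "b \<in> B \<rightarrow>\<^sub>E carrier G" by fact
    have MinB: "Min B \<in> B" using dnf_Min(1)[OF x B b] .
    have zB: "i \<in> zero_block n \<beta>" if "i \<in> B" for i
    proof -
      have "i \<in> pts" using dowling_block_set(2)[OF x B] that by blast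
      moreover have "i \<notin> fst p" if "p \<in> \<beta>" for p
        using dowling_block_unique[OF x B, of p i] that \<open>i \<in> B\<close> color(7) by auto
      ultimately show ?thesis by (simp add: zero_block_iff)
    qed
    have below: "below (dnf (?\<beta>, z)) (dnf (\<beta>, z'))"
      unfolding below_def
    proof
      fix i assume "i \<in> pts"
      with x show "subst (dnf (\<beta>, z')) (dnf (?\<beta>, z) i) = dnf (\<beta>, z') i"
      proof (cases rule: dowling_cases)
        case zero
        then have "i \<in> zero_block n \<beta>" by (simp add: zero_block_iff)
        then show ?thesis using zero(1,2) color by (simp add: dnf_zero)
      next
        case (blk E e)
        then consider "block G E e \<in> \<beta>" | "block G E e = block G B b" by auto
        then show ?thesis
        proof cases
          case 1
          have "e i \<in> carrier G" "e (Min E) \<in> carrier G"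
            using blk(2,3) dnf_Min(1)[OF x blk(1,2)] by (auto intro: PiE_const_mem)
          then show ?thesis
            using blk(6) dnf_block[OF y 1 blk(2,3)] dnf_Min(2)[OF y 1 blk(2)] by simp
        next
          case 2
          then have i: "i \<in> B" using blk(3) by (simp add: block_def)
          have h: "dnf (?\<beta>, z) i = Inl (Min B, b i \<otimes> inv b (Min B))"
            by (rule dnf_block[OF x B b i])
          have k: "dnf (\<beta>, z') j = Inr (act (b j) s)" if "j \<in> B" for j
            using dnf_zero[OF zB[OF that]] color that by simp
          have cl: "b i \<in> carrier G" "b (Min B) \<in> carrier G"
            using b i MinB PiE_const_mem by fast+
          \<comment> \<open>The colour of \<open>Min B\<close> determines the colours of the whole
            block, as \<open>inv b (Min B)\<close> undoes the action of
            \<open>b (Min B)\<close>.\<close>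
          have "act (b i \<otimes> inv b (Min B)) (act (b (Min B)) s) = act (b i) s"
            using cl color(10) by (simp add: m_assoc flip: composition_rule)
          then show ?thesis using h k[OF i] k[OF MinB] by simp
        qed
      qed
    qed
    have "Min B \<in> roots (dnf (?\<beta>, z))"
      unfolding roots_dnf[OF x] by simp
    moreover have "Min B \<notin> roots (dnf (\<beta>, z'))"
      using dnf_zero[OF zB[OF MinB]] by (simp add: roots_def)
    then have "roots (dnf (\<beta>, z')) = roots (dnf (?\<beta>, z)) - {Min B}"
      unfolding roots_dnf[OF x] roots_dnf[OF y] by auto
    ultimately have "(?\<beta>, z) \<in> D \<and> (\<beta>, z') \<in> D \<and> below (dnf (?\<beta>, z)) (dnf (\<beta>, z')) \<and>
      (\<exists>m\<in>roots (dnf (?\<beta>, z)). roots (dnf (\<beta>, z')) = roots (dnf (?\<beta>, z)) - {m})"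
      using x y below by blast
    moreover have "x = (?\<beta>, z)" "y = (\<beta>, z')" using color(1-4) by (simp_all add: prod_eq_iff)
    ultimately show ?thesis by simp
  qed
qed

text \<open>Sending \<open>m\<close> to a multiple of \<open>m'\<close> merges the class of
  \<open>m\<close> into that of \<open>m'\<close>, and sending it to a colour colours its class. The
  blocks at all other roots and the colours already present do not change.\<close>

lemma step_cover:
  assumes "normal h" "normal k" "step h m e k"
  shows "(realize h, realize k) \<in> dowling_cover n G S act"
proof -
  have leg: "legal h m e" and k: "\<And>i. i \<in> pts \<Longrightarrow> k i = subst (assign m e) (h i)"
    using assms(3) by (auto simp: step_def)
  have m: "m \<in> roots h" using leg by (simp add: legal_def)
  have rk: "roots k = roots h - {m}" by (rule step_roots[OF assms(3,1)])
  have k_other: "k i = h i" if "i \<in> pts" "h i = Inl (p, u)" "p \<noteq> m" for i p u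
    using k[OF that(1)] that normalD(2)[OF assms(1) that(1,2)] by simp
  have k_const: "k i = Inr s" if "i \<in> pts" "h i = Inr s" for i s
    using k[OF that(1)] that by simp
  have k_root: "k i = scale u e" if "i \<in> pts" "h i = Inl (m, u)" for i u
    using k[OF that(1)] that by simp
  have same: "root_block k p = root_block h p"
    if "p \<noteq> m" "\<And>i u v. i \<in> pts \<Longrightarrow> h i = Inl (m, u) \<Longrightarrow> k i \<noteq> Inl (p, v)" for p
  proof -
    have c: "root_class k p = root_class h p"
    proof (rule Set.set_eqI)
      fix i
      show "i \<in> root_class k p \<longleftrightarrow> i \<in> root_class h p"
      proof (cases "i \<in> pts")
        case True
        with assms(1) show ?thesis
        proof (cases rule: normal_cases)
          case (root q u)
          then show ?thesis
            using True that k_other[OF True root(1)] by (cases "q = m") (auto simp: root_class_def)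
        next
          case (const s)
          then show ?thesis using k_const[OF True] by (simp add: root_class_def)
        qed
      qed (simp add: root_class_def)
    qed
    have "twist k p = twist h p"
      unfolding twist_def c
      by (rule restrict_ext) (use k_other that(1) in \<open>auto simp: root_class_def\<close>)
    then show ?thesis by (simp add: root_block_def c)
  qed
  have blk_inj: "p = q" if "p \<in> roots h" "root_block h p = root_block h q" for p q
  proof -
    have "root_class h p = root_class h q" using that(2) by (simp add: root_block_def block_def)
    then have "p \<in> root_class h q" using root_in_class[OF that(1)] by simp
    then show ?thesis using rootsD[OF that(1)] by (simp add: root_class_def)
  qed
  have hD: "(root_block h ` roots h, colours h) \<in> D" and kD: "(root_block k ` roots k, colours k) \<in> D"
    using realize_dowling assms(1,2) by (simp_all add: realize_def)
  from leg consider (merge) m' g where "m' \<in> roots h" "g \<in> carrier G" "m' < m" "e = Inl (m', g)"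
    | (color) s where "s \<in> S" "e = Inr s"
    unfolding legal_def by blast
  then show ?thesis
  proof cases
    case merge
    let ?\<beta> = "root_block h ` (roots h - {m, m'})"
    let ?A = "root_class h m'" and ?B = "root_class h m"
    \<comment> \<open>The group element \<open>u\<close> at a point of the class of \<open>m\<close>
      becomes \<open>u \<otimes> g\<close>. So \<open>g\<close> acts from the right, as the merge
      relation demands, with the class of \<open>m'\<close> as \<open>A\<close> and that of
      \<open>m\<close> as \<open>B\<close>.\<close>
    have kr: "k i = Inl (m', u \<otimes> g)" if "i \<in> pts" "h i = Inl (m, u)" for i u
      using k_root[OF that] merge by simp
    have ne: "m' \<noteq> m" using merge by simp
    have cl: "root_class k m' = ?A \<union> ?B"
    proof (rule Set.set_eqI)
      fix i
      show "i \<in> root_class k m' \<longleftrightarrow> i \<in> ?A \<union> ?B"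
      proof (cases "i \<in> pts")
        case True
        with assms(1) show ?thesis
        proof (cases rule: normal_cases)
          case (root q u)
          then show ?thesis
            using True k_other[OF True root(1)] kr[OF True] by (cases "q = m") (auto simp: root_class_def)
        next
          case (const s)
          then show ?thesis using k_const[OF True] by (simp add: root_class_def)
        qed
      qed (simp add: root_class_def)
    qed
    have eqh: "root_block h ` roots h = ?\<beta> \<union> {block G ?A (twist h m'), block G ?B (twist h m)}"
      using m merge(1) by (auto simp: root_block_def)
    have same': "root_block k p = root_block h p" if "p \<in> roots h - {m, m'}" for p
      using that kr by (intro same) auto
    have "root_block k ` roots k = root_block k ` (roots h - {m, m'}) \<union> {root_block k m'}"
      using rk merge(1) ne by auto
    also have "root_block k ` (roots h - {m, m'}) = ?\<beta>"
      using same' by (rule image_cong[OF refl])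
    finally have eqk: "root_block k ` roots k = ?\<beta> \<union> {block G (?A \<union> ?B) (twist k m')}"
      by (simp add: root_block_def cl)
    have const_iff: "(\<exists>s. k i = Inr s) \<longleftrightarrow> (\<exists>s. h i = Inr s)" if "i \<in> pts" for i
      using assms(1) that
    proof (cases rule: normal_cases)
      case (root q u)
      then show ?thesis using k_other[OF that root(1)] kr[OF that] by (cases "q = m") auto
    qed (use k_const that in auto)
    have colk: "colours k = colours h"
    proof -
      have "{i \<in> pts. \<exists>s. k i = Inr s} = {i \<in> pts. \<exists>s. h i = Inr s}"
        using const_iff by blast
      then show ?thesis
        unfolding colours_def using k_const by (auto intro!: restrict_ext)
    qed
    have "((?\<beta> \<union> {block G ?A (twist h m'), block G ?B (twist h m)}, colours h),
        (?\<beta> \<union> {block G (?A \<union> ?B) (twist k m')}, colours h)) \<in> dowling_cover n G S act"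
    proof (rule dowling_cover.merge)
      show "(?\<beta> \<union> {block G ?A (twist h m'), block G ?B (twist h m)}, colours h) \<in> D"
        using hD unfolding eqh .
      show "(?\<beta> \<union> {block G (?A \<union> ?B) (twist k m')}, colours h) \<in> D"
        using kD unfolding eqk colk .
      show "block G ?A (twist h m') \<notin> ?\<beta>" "block G ?B (twist h m) \<notin> ?\<beta>"
        using blk_inj[OF m] blk_inj[OF merge(1)] unfolding root_block_def[symmetric] by blast+
      show "block G ?A (twist h m') \<noteq> block G ?B (twist h m)"
        using blk_inj[OF m] ne unfolding root_block_def[symmetric] by metis
      show "twist h m' \<in> ?A \<rightarrow>\<^sub>E carrier G" "twist h m \<in> ?B \<rightarrow>\<^sub>E carrier G"
        by (rule twist_PiE[OF assms(1)])+
      show "twist k m' \<in> ?A \<union> ?B \<rightarrow>\<^sub>E carrier G"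
        using twist_PiE[OF assms(2), of m'] cl by simp
      show "g \<in> carrier G" by fact
      show "\<forall>i\<in>?A. twist k m' i = twist h m' i"
      proof
        fix i assume "i \<in> ?A"
        then obtain u where i: "i \<in> pts" "h i = Inl (m', u)" by (auto simp: root_class_def)
        then have "k i = Inl (m', u)" using k_other ne by simp
        then show "twist k m' i = twist h m' i" using i twist_eq by simp
      qed
      show "\<forall>i\<in>?B. twist k m' i = twist h m i \<otimes> g"
      proof
        fix i assume "i \<in> ?B"
        then obtain u where i: "i \<in> pts" "h i = Inl (m, u)" by (auto simp: root_class_def)
        then show "twist k m' i = twist h m i \<otimes> g" using kr twist_eq by simp
      qed
    qed
    then show ?thesis by (simp add: realize_def eqh eqk colk)
  next
    case color
    let ?\<beta> = "root_block h ` (roots h - {m})"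
    let ?B = "root_class h m"
    have kr: "k i = Inr (act u s)" if "i \<in> pts" "h i = Inl (m, u)" for i u
      using k_root[OF that] color by simp
    have eqh: "root_block h ` roots h = ?\<beta> \<union> {block G ?B (twist h m)}"
      using m by (auto simp: root_block_def)
    have same': "root_block k p = root_block h p" if "p \<in> roots h - {m}" for p
      using that kr by (intro same) auto
    have eqk: "root_block k ` roots k = ?\<beta>"
      unfolding rk using same' by (rule image_cong[OF refl])
    have "((?\<beta> \<union> {block G ?B (twist h m)}, colours h), (?\<beta>, colours k)) \<in> dowling_cover n G S act"
    proof (rule dowling_cover.color)
      show "(?\<beta> \<union> {block G ?B (twist h m)}, colours h) \<in> D"
        using hD unfolding eqh .
      show "(?\<beta>, colours k) \<in> D"
        using kD unfolding eqk .
      show "block G ?B (twist h m) \<notin> ?\<beta>"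
        using blk_inj[OF m] unfolding root_block_def[symmetric] by blast
      show "twist h m \<in> ?B \<rightarrow>\<^sub>E carrier G"
        by (rule twist_PiE[OF assms(1)])
      show "s \<in> S" by fact
      show "\<forall>i\<in>zero_block n (?\<beta> \<union> {block G ?B (twist h m)}). colours k i = colours h i"
        unfolding eqh[symmetric] zero_block_realize[OF assms(1)]
        using k_const by (auto simp: colours_def)
      show "\<forall>i\<in>?B. colours k i = act (twist h m i) s"
      proof
        fix i assume "i \<in> ?B"
        then obtain u where i: "i \<in> pts" "h i = Inl (m, u)" by (auto simp: root_class_def)
        then show "colours k i = act (twist h m i) s"
          using kr[OF i] twist_eq[of i h, OF i] by (simp add: colours_def)
      qed
    qed
    then show ?thesis by (simp add: realize_def eqh eqk)
  qed
qed

text \<open>A cover goes up in the order and loses one root, so it is a step by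
  \<open>step_of_below\<close>. A step is realised by a cover, and \<open>realize\<close> inverts
  \<open>dnf\<close>.\<close>

lemma cover_iff:
  "(x, y) \<in> dowling_cover n G S act \<longleftrightarrow> x \<in> D \<and> y \<in> D \<and> (\<exists>m e. step (dnf x) m e (dnf y))"
proof -
  have nf: "normal (dnf w)" "realize (dnf w) = w" if "w \<in> D" for w
    using normal_dnf[of "fst w" "snd w"] realize_dnf[of "fst w" "snd w"] that by simp_all
  show ?thesis
  proof
    assume "(x, y) \<in> dowling_cover n G S act"
    from cover_below[OF this] obtain m where xy: "x \<in> D" "y \<in> D" "below (dnf x) (dnf y)"
        "m \<in> roots (dnf x)" "roots (dnf y) = roots (dnf x) - {m}"
      by blast
    from step_of_below[OF nf(1)[OF xy(1)] nf(1)[OF xy(2)] xy(3-5)]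
    show "x \<in> D \<and> y \<in> D \<and> (\<exists>m e. step (dnf x) m e (dnf y))"
      using xy by blast
  next
    assume "x \<in> D \<and> y \<in> D \<and> (\<exists>m e. step (dnf x) m e (dnf y))"
    then obtain m e where xy: "x \<in> D" "y \<in> D" "step (dnf x) m e (dnf y)" by blast
    then show "(x, y) \<in> dowling_cover n G S act"
      using step_cover[OF nf(1) nf(1) xy(3)] nf(2) by simp
  qed
qed

sublocale substitution_poset G S act pts D "dowling_cover n G S act" dnf
proof
  show "normal (dnf x)" if "x \<in> D" for x
    using normal_dnf[of "fst x" "snd x"] that by simp
  show "\<exists>x\<in>D. \<forall>i\<in>pts. dnf x i = h i" if "normal h" for h
    using realize_dowling dnf_realize that by blast
qed (rule dnf_inj cover_iff; assumption)+

end

theorem theoremA: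
  fixes n :: nat
    and G :: "('g, 'm) monoid_scheme"
    and S :: "'s set"
    and act :: "'g \<Rightarrow> 's \<Rightarrow> 's"
  assumes "n > 0"
    and "group G" and "finite (carrier G)"
    and "finite S" and "group_action G S act"
  shows "EL_shellable (add_top (dowling n G S))
    (add_top_rel (dowling n G S) (dowling_le n G S act))"
proof -
  interpret dowling_setup G S act n
    using assms by (simp add: dowling_setup_def dowling_setup_axioms_def)
  show ?thesis
    \<comment> \<open>With these parameters \<open>le\<close> is the closure of the Dowling covers,
      which is \<open>dowling_le\<close>.\<close>
    using EL_shellable_top_rel by (simp add: le_def dowling_le_def)
qed

end
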